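(* Let $K=2$, let $q_{10},q_{01}\in[0,1]$ be the noise parameters of the noisy Boolean multi-access channel, and let the entries of the $N\times T$ transmission matrix $\mathbf{X}$ be i.i.d. Bernoulli with $\Pr(x_{i,t}=1)=p$. For $w\in\{0,1\}$ let $p_w=\Pr(y_t=w)$ and $$\varphi_w'=\frac{1}{p_w}\sup_{\lambda\in\mathbb{R}}\left(p_{y,x_1,x_2}(w,0,0)\log\frac{e^{2\lambda}}{p+(1-p)e^{2\lambda}}-2\,p_{y,x_1,x_2}(w,1,0)\log\big(p+(1-p)e^{\lambda}\big)\right),$$ and define $$D(p,q_{10},q_{01})=p_1\varphi_1'+p_0\varphi_0'$$ (with $p_w\varphi_w':=0$ if $p_w=0$). Then for every constant $\xi>0$: if $T=T(N)$ satisfies $\frac{T}{\log N}\le \frac{1}{D(p,q_{10},q_{01})}-\xi$, then, no matter how the constant $\epsilon>0$ in the typical-set decoding rule is chosen, $$P_3\to 1\quad\text{as }N\to\infty,$$ where $P_3$ is the probability that the decoding graph $\mathcal{H}'_T$ contains a 1-odd cycle of length $3$ or does not contain the edge $\{1,2\}$.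
   Context: Logarithms are natural. There are $N$ users $\{1,\dots,N\}$, and (by symmetry) the set of active users is taken to be $\{1,2\}$. Channel: for $\mathbf{X}=[x_{i,t}]\in\{0,1\}^{N\times T}$ let $\mathbf{x}_i=(x_{i,1},\dots,x_{i,T})$ be the codeword of user $i$. The noiseless output at round $t$ is $y_{0,t}=x_{1,t}\vee x_{2,t}$. The observed output $\mathbf{y}=(y_1,\dots,y_T)\in\{0,1\}^T$ satisfies, independently over $t$, $\Pr(y_t=1\mid y_{0,t}=0)=q_{10}$ and $\Pr(y_t=0\mid y_{0,t}=1)=q_{01}$. Probabilities: $p_x(1)=p$, $p_x(0)=1-p$; $p_{y|y_0}(w|w_0)=\Pr(y_t=w\mid y_{0,t}=w_0)$; $p_{y,x_1,x_2}(w,u,v)=p_{y|y_0}(w\mid u\vee v)\,p_x(u)\,p_x(v)$ is the joint law of $(y_t,x_{1,t},x_{2,t})$; $p_{y,y_0}(w,1)=p_{y|y_0}(w|1)(1-(1-p)^2)$ and $p_{y,y_0}(w,0)=p_{y|y_0}(w|0)(1-p)^2$ is the joint law of $(y_t,y_{0,t})$. Thus $p_1=(1-(1-p)^2)(1-q_{01})+(1-p)^2q_{10}$ and $p_0=1-p_1$. Strong typical set: for $\epsilon>0$, $\mathcal{E}_\epsilon^T$ is the set of pairs $[\tilde{\mathbf{y}},\tilde{\mathbf{y}}_0]$ of vectors in $\{0,1\}^T$ such that for every $a=(w,w_0)\in\{0,1\}^2$, with $N(a\mid[\tilde{\mathbf{y}},\tilde{\mathbf{y}}_0])$ denoting the number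 of $t$ with $(\tilde y_t,\tilde y_{0,t})=a$: $\left|\frac1T N(a\mid[\tilde{\mathbf{y}},\tilde{\mathbf{y}}_0])-p_{y,y_0}(a)\right|\le\epsilon/4$ if $p_{y,y_0}(a)>0$, and $N(a\mid[\tilde{\mathbf{y}},\tilde{\mathbf{y}}_0])=0$ if $p_{y,y_0}(a)=0$. Decoding graph: $\mathcal{H}'_T$ is the random graph on vertex set $\{1,\dots,N\}$ in which $\{i,j\}$ ($i\ne j$) is an edge iff $[\mathbf{y},\mathbf{x}_i\vee\mathbf{x}_j]\in\mathcal{E}_\epsilon^T$ ($\vee$ taken componentwise). A 1-odd cycle is an odd cycle of $\mathcal{H}'_T$ having $\{1,2\}$ as one of its edges; a 1-odd cycle of length $3$ is thus a triangle $(1,2,i)$. $P_3$ is computed over the randomness of $\mathbf{X}$ and the channel noise. *)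

theory Defs
  imports "HOL-Probability.Probability"
begin

text \<open>
  Binary symbols are of type \<^typ>\<open>bool\<close> (\<^term>\<open>True\<close> is 1, \<^term>\<open>False\<close> is 0).
  Users are numbered \<^term>\<open>{1..N}\<close> and rounds \<^term>\<open>{1..T}\<close>; the active users are 1 and 2.
  A vector in \<open>{0,1}\<^sup>T\<close> is a function \<^typ>\<open>nat \<Rightarrow> bool\<close> that is only inspected on
  \<^term>\<open>{1..T}\<close>.
\<close>

definition px :: "real \<Rightarrow> bool \<Rightarrow> real" where
  "px p u = (if u then p else 1 - p)"

definition p_chan :: "real \<Rightarrow> real \<Rightarrow> bool \<Rightarrow> bool \<Rightarrow> real" where
  "p_chan q10 q01 w w0 =
     (if w0 then (if w then 1 - q01 else q01) else (if w then q10 else 1 - q10))"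

definition p_yxx :: "real \<Rightarrow> real \<Rightarrow> real \<Rightarrow> bool \<Rightarrow> bool \<Rightarrow> bool \<Rightarrow> real" where
  "p_yxx p q10 q01 w u v = p_chan q10 q01 w (u \<or> v) * px p u * px p v"

definition p_yy0 :: "real \<Rightarrow> real \<Rightarrow> real \<Rightarrow> bool \<Rightarrow> bool \<Rightarrow> real" where
  "p_yy0 p q10 q01 w w0 =
     p_chan q10 q01 w w0 * (if w0 then 1 - (1 - p)^2 else (1 - p)^2)"

definition p_out1 :: "real \<Rightarrow> real \<Rightarrow> real \<Rightarrow> real" where
  "p_out1 p q10 q01 = (1 - (1 - p)^2) * (1 - q01) + (1 - p)^2 * q10"

definition p_out :: "real \<Rightarrow> real \<Rightarrow> real \<Rightarrow> bool \<Rightarrow> real" where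
  "p_out p q10 q01 w = (if w then p_out1 p q10 q01 else 1 - p_out1 p q10 q01)"

definition objective :: "real \<Rightarrow> real \<Rightarrow> real \<Rightarrow> bool \<Rightarrow> real \<Rightarrow> real" where
  "objective p q10 q01 w l =
     p_yxx p q10 q01 w False False * ln (exp (2 * l) / (p + (1 - p) * exp (2 * l)))
     - 2 * p_yxx p q10 q01 w True False * ln (p + (1 - p) * exp l)"

text \<open>
  The real-valued supremum below is meaningful: for parameters in \<open>[0,1]\<close> the objective is
  bounded above, see \<open>bdd_above_objective\<close>.  If \<open>p_out p q10 q01 w = 0\<close>, then \<open>phi'\<close>
  is 0 by the convention for division by 0, so that the corresponding summand of
  \<open>D_exp\<close> vanishes.
\<close>

definition phi' :: "real \<Rightarrow> real \<Rightarrow> real \<Rightarrow> bool \<Rightarrow> real" where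
  "phi' p q10 q01 w = 1 / p_out p q10 q01 w * (SUP l. objective p q10 q01 w l)"

definition D_exp :: "real \<Rightarrow> real \<Rightarrow> real \<Rightarrow> real" where
  "D_exp p q10 q01 =
     p_out p q10 q01 True * phi' p q10 q01 True + p_out p q10 q01 False * phi' p q10 q01 False"

lemma bdd_above_objective:
  assumes "p \<in> {0..1}" "q10 \<in> {0..1}" "q01 \<in> {0..1}"
  shows "bdd_above (range (objective p q10 q01 w))"
proof -
  define a where "a = p_yxx p q10 q01 w False False"
  define b where "b = p_yxx p q10 q01 w True False"
  have nonneg: "a \<ge> 0" "b \<ge> 0"
    using assms by (auto simp: a_def b_def p_yxx_def p_chan_def px_def)
  have obj: "objective p q10 q01 w l =
      a * ln (exp (2 * l) / (p + (1 - p) * exp (2 * l))) - 2 * b * ln (p + (1 - p) * exp l)" for l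
    by (simp add: objective_def a_def b_def)
  consider "p = 0" | "p = 1" | "0 < p" "p < 1"
    using assms by force
  then show ?thesis
  proof cases
    case 1
    then have "b = 0" by (simp add: b_def p_yxx_def px_def)
    then have "objective p q10 q01 w l \<le> 0" for l
      unfolding obj using 1 by simp
    then show ?thesis by (auto intro!: bdd_aboveI)
  next
    case 2
    then have "a = 0" "b = 0" by (auto simp: a_def b_def p_yxx_def px_def)
    then have "objective p q10 q01 w l \<le> 0" for l
      unfolding obj by simp
    then show ?thesis by (auto intro!: bdd_aboveI)
  next
    case 3
    have "objective p q10 q01 w l \<le> a * ln (1 / (1 - p)) - 2 * b * ln p" for l
    proof -
      have pos: "p + (1 - p) * exp (2 * l) > 0"
        using 3 by (intro add_pos_nonneg) auto
      have "exp (2 * l) / (p + (1 - p) * exp (2 * l)) \<le> 1 / (1 - p)"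
        using 3 pos by (simp add: field_simps)
      then have "ln (exp (2 * l) / (p + (1 - p) * exp (2 * l))) \<le> ln (1 / (1 - p))"
        using 3 pos by (subst ln_le_cancel_iff) auto
      moreover have "ln p \<le> ln (p + (1 - p) * exp l)"
        using 3 by (subst ln_le_cancel_iff) (auto intro: add_pos_nonneg)
      ultimately show ?thesis
        unfolding obj using nonneg by (intro diff_mono mult_left_mono) auto
    qed
    then show ?thesis by (auto intro!: bdd_aboveI)
  qed
qed

definition matrix_pmf :: "nat \<Rightarrow> nat \<Rightarrow> real \<Rightarrow> (nat \<times> nat \<Rightarrow> bool) pmf" where
  "matrix_pmf N T p = Pi_pmf ({1..N} \<times> {1..T}) False (\<lambda>_. bernoulli_pmf p)"

definition codeword :: "(nat \<times> nat \<Rightarrow> bool) \<Rightarrow> nat \<Rightarrow> nat \<Rightarrow> bool" where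
  "codeword X i = (\<lambda>t. X (i, t))"

definition vec_or :: "(nat \<Rightarrow> bool) \<Rightarrow> (nat \<Rightarrow> bool) \<Rightarrow> nat \<Rightarrow> bool" where
  "vec_or u v = (\<lambda>t. u t \<or> v t)"

definition channel_pmf :: "nat \<Rightarrow> real \<Rightarrow> real \<Rightarrow> (nat \<Rightarrow> bool) \<Rightarrow> (nat \<Rightarrow> bool) pmf" where
  "channel_pmf T q10 q01 y0 =
     Pi_pmf {1..T} False (\<lambda>t. bernoulli_pmf (p_chan q10 q01 True (y0 t)))"

definition system_pmf ::
  "nat \<Rightarrow> nat \<Rightarrow> real \<Rightarrow> real \<Rightarrow> real \<Rightarrow> ((nat \<times> nat \<Rightarrow> bool) \<times> (nat \<Rightarrow> bool)) pmf" where
  "system_pmf N T p q10 q01 =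
     bind_pmf (matrix_pmf N T p) (\<lambda>X.
       map_pmf (\<lambda>y. (X, y))
         (channel_pmf T q10 q01 (vec_or (codeword X 1) (codeword X 2))))"

definition occurrences :: "nat \<Rightarrow> bool \<times> bool \<Rightarrow> (nat \<Rightarrow> bool) \<Rightarrow> (nat \<Rightarrow> bool) \<Rightarrow> nat" where
  "occurrences T a ys ys0 = card {t \<in> {1..T}. (ys t, ys0 t) = a}"

definition typical_set ::
  "real \<Rightarrow> real \<Rightarrow> real \<Rightarrow> real \<Rightarrow> nat \<Rightarrow> ((nat \<Rightarrow> bool) \<times> (nat \<Rightarrow> bool)) set" where
  "typical_set p q10 q01 \<epsilon> T = {(ys, ys0). \<forall>w w0.
     (p_yy0 p q10 q01 w w0 > 0 \<longrightarrow>
        \<bar>1 / real T * real (occurrences T (w, w0) ys ys0) - p_yy0 p q10 q01 w w0\<bar> \<le> \<epsilon> / 4) \<and>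
     (p_yy0 p q10 q01 w w0 = 0 \<longrightarrow> occurrences T (w, w0) ys ys0 = 0)}"

text \<open>Edge set of the decoding graph on the vertex set \<^term>\<open>{1..N}\<close>.\<close>

definition decoding_graph ::
  "real \<Rightarrow> real \<Rightarrow> real \<Rightarrow> real \<Rightarrow> nat \<Rightarrow> nat \<Rightarrow> (nat \<times> nat \<Rightarrow> bool) \<Rightarrow> (nat \<Rightarrow> bool)
     \<Rightarrow> nat set set" where
  "decoding_graph p q10 q01 \<epsilon> N T X y =
     {{i, j} | i j. i \<in> {1..N} \<and> j \<in> {1..N} \<and> i \<noteq> j \<and>
        (y, vec_or (codeword X i) (codeword X j)) \<in> typical_set p q10 q01 \<epsilon> T}"

text \<open>
  A cycle of a graph, given by its set of edges, is represented by the list of its vertices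
  in cyclic order; its length is the length of the list.
\<close>

definition cycle_edges :: "'a list \<Rightarrow> 'a set set" where
  "cycle_edges c = {{c ! k, c ! (Suc k mod length c)} | k. k < length c}"

definition is_cycle :: "'a set set \<Rightarrow> 'a list \<Rightarrow> bool" where
  "is_cycle E c \<longleftrightarrow> length c \<ge> 3 \<and> distinct c \<and> cycle_edges c \<subseteq> E"

definition one_odd_cycle :: "nat set set \<Rightarrow> nat list \<Rightarrow> bool" where
  "one_odd_cycle E c \<longleftrightarrow> is_cycle E c \<and> odd (length c) \<and> {1, 2} \<in> cycle_edges c"

definition P3 :: "real \<Rightarrow> real \<Rightarrow> real \<Rightarrow> real \<Rightarrow> nat \<Rightarrow> nat \<Rightarrow> real" where
  "P3 p q10 q01 \<epsilon> N T =
     measure_pmf.prob (system_pmf N T p q10 q01)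
       {(X, y). (\<exists>c. one_odd_cycle (decoding_graph p q10 q01 \<epsilon> N T X y) c \<and> length c = 3) \<or>
                {1, 2} \<notin> decoding_graph p q10 q01 \<epsilon> N T X y}"

end

theory Submission
  imports Defs "HOL-Real_Asymp.Real_Asymp"
begin

text \<open>
  Given \<open>(y, x\<^sub>1, x\<^sub>2)\<close>, the remaining codewords are independent, so it suffices that a single
  random codeword forms a triangle with probability much larger than \<open>1/N\<close>.  Redraw its
  bit in each round with a probability \<open>\<gamma> w u v\<close> depending on the symbols \<open>(y, x\<^sub>1, x\<^sub>2) = (w, u, v)\<close>
  of that round, chosen such that \<open>(y, x\<^sub>1 \<or> x\<^sub>i)\<close> and \<open>(y, x\<^sub>2 \<or> x\<^sub>i)\<close> have the law of
  \<open>(y, y\<^sub>0)\<close>.  By the weak law of large numbers both pairs are then typical and the log likelihood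
  ratio is about \<open>T\<close> times the relative entropy, so the triangle probability is at least about
  \<open>exp (- T D')\<close>, \<open>D'\<close> being the relative entropy.  Tilting by the maximiser of the objective
  (which is concave in \<open>\<lambda>\<close>) gives \<open>D' = D\<close>: the moment condition is the stationarity condition.
  The weak law needs \<open>T \<rightarrow> \<infinity>\<close>; for bounded \<open>T\<close>, the codeword \<open>x\<^sub>i = x\<^sub>1 \<or> x\<^sub>2\<close> has
  probability bounded below and yields a triangle whenever \<open>{1, 2}\<close> is an edge.
\<close>

section \<open>Finitely supported product distributions\<close>

lemma expectation_bind_pmf_finite:
  fixes h :: "'b \<Rightarrow> real"
  assumes "finite (set_pmf M)" "\<And>x. x \<in> set_pmf M \<Longrightarrow> finite (set_pmf (f x))"
  shows "measure_pmf.expectation (bind_pmf M f) h =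
    measure_pmf.expectation M (\<lambda>x. measure_pmf.expectation (f x) h)"
  using assms
  by (subst pmf_expectation_bind[where A = "set_pmf M"])
     (auto simp: integral_measure_pmf[where A = "set_pmf M" and M = M])

lemma expectation_pmf_mono:
  fixes f g :: "'a \<Rightarrow> real"
  assumes "finite (set_pmf M)" "\<And>x. x \<in> set_pmf M \<Longrightarrow> f x \<le> g x"
  shows "measure_pmf.expectation M f \<le> measure_pmf.expectation M g"
  using assms
  by (intro integral_mono_AE integrable_measure_pmf_finite) (auto simp: AE_measure_pmf_iff)

lemma finite_set_Pi_pmf:
  assumes "finite A" "\<And>x. x \<in> A \<Longrightarrow> finite (set_pmf (p x))"
  shows "finite (set_pmf (Pi_pmf A d p))"
  using assms finite_PiE_dflt[of A "set_pmf \<circ> p" d] by (simp add: set_Pi_pmf)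

text \<open>Uncurrying is injective, so the mass functions can be compared point by point. It serves
  to view the i.i.d. matrix as i.i.d. rows, from which rows 1 and 2 can be split off.\<close>

lemma Pi_pmf_Times:
  assumes "finite A" "finite B"
  shows "map_pmf (\<lambda>g (i, t). g i t) (Pi_pmf A (\<lambda>_. d) (\<lambda>i. Pi_pmf B d (p i))) =
    Pi_pmf (A \<times> B) d (\<lambda>(i, t). p i t)"
proof (rule pmf_eqI)
  fix f :: "'a \<times> 'b \<Rightarrow> 'c"
  define g where "g = (\<lambda>i t. f (i, t))"
  have f: "f = (\<lambda>g (i, t). g i t) g" by (auto simp: g_def)
  have "pmf (map_pmf (\<lambda>g (i, t). g i t) (Pi_pmf A (\<lambda>_. d) (\<lambda>i. Pi_pmf B d (p i)))) f =
    pmf (Pi_pmf A (\<lambda>_. d) (\<lambda>i. Pi_pmf B d (p i))) g"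
    unfolding f by (rule pmf_map_inj') (auto simp: inj_def fun_eq_iff)
  also have "\<dots> = pmf (Pi_pmf (A \<times> B) d (\<lambda>(i, t). p i t)) f"
  proof (cases "\<forall>x. x \<notin> A \<times> B \<longrightarrow> f x = d")
    case True
    then have "\<forall>i. i \<notin> A \<longrightarrow> g i = (\<lambda>_. d)" "\<forall>i t. t \<notin> B \<longrightarrow> g i t = d" by (auto simp: g_def)
    then show ?thesis using True assms
      by (simp add: pmf_Pi prod.cartesian_product) (simp add: g_def case_prod_unfold)
  next
    case False
    \<comment> \<open>A non-default value off \<open>A \<times> B\<close> sits either at a position
      \<open>t \<notin> B\<close> of a row \<open>i \<in> A\<close>, or in a row
      \<open>i \<notin> A\<close>, which should be constant. Both give mass 0.\<close>
    then obtain i t where it: "(i, t) \<notin> A \<times> B" "g i t \<noteq> d" by (auto simp: g_def)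
    have "pmf (Pi_pmf A (\<lambda>_. d) (\<lambda>i. Pi_pmf B d (p i))) g = 0"
    proof (cases "i \<in> A")
      case True
      then show ?thesis using it assms by (auto simp: pmf_Pi intro!: bexI[of _ i] exI[of _ t])
    next
      case False
      then show ?thesis using it assms by (auto simp: pmf_Pi fun_eq_iff)
    qed
    moreover have "pmf (Pi_pmf (A \<times> B) d (\<lambda>(i, t). p i t)) f = 0"
      using False assms by (intro pmf_Pi_outside) auto
    ultimately show ?thesis by simp
  qed
  finally show "pmf (map_pmf (\<lambda>g (i, t). g i t) (Pi_pmf A (\<lambda>_. d) (\<lambda>i. Pi_pmf B d (p i)))) f =
    pmf (Pi_pmf (A \<times> B) d (\<lambda>(i, t). p i t)) f" .
qed

text \<open>Variances of independent centred summands add: in the induction step the cross term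
  carries the factor \<open>expectation J g = 0\<close>.\<close>

lemma expectation_sum_square_Pi_pmf:
  fixes g :: "'a \<Rightarrow> real"
  assumes "finite A" "finite (set_pmf J)" and zero: "measure_pmf.expectation J g = 0"
  shows "measure_pmf.expectation (Pi_pmf A d (\<lambda>_. J)) (\<lambda>w. (\<Sum>t\<in>A. g (w t))\<^sup>2) =
    real (card A) * measure_pmf.expectation J (\<lambda>x. (g x)\<^sup>2)"
  using assms(1)
proof (induction A rule: finite_induct)
  case (insert a A)
  let ?P = "Pi_pmf A d (\<lambda>_. J)"
  have fin: "finite (set_pmf ?P)" using insert assms by (intro finite_set_Pi_pmf)
  note int = integrable_measure_pmf_finite[OF fin] integrable_measure_pmf_finite[OF assms(2)]
  have upd: "(\<Sum>t\<in>A. g ((w(a := x)) t)) = (\<Sum>t\<in>A. g (w t))" for w x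
    using insert by (intro sum.cong) auto
  have "measure_pmf.expectation (Pi_pmf (insert a A) d (\<lambda>_. J)) (\<lambda>w. (\<Sum>t\<in>insert a A. g (w t))\<^sup>2) =
    measure_pmf.expectation J (\<lambda>x. measure_pmf.expectation ?P (\<lambda>w. (g x + (\<Sum>t\<in>A. g (w t)))\<^sup>2))"
    using insert assms fin
    by (simp add: Pi_pmf_insert' expectation_bind_pmf_finite upd del: fun_upd_apply) simp
  also have "\<dots> = measure_pmf.expectation J (\<lambda>x. (g x)\<^sup>2 +
      2 * g x * measure_pmf.expectation ?P (\<lambda>w. \<Sum>t\<in>A. g (w t)) +
      measure_pmf.expectation ?P (\<lambda>w. (\<Sum>t\<in>A. g (w t))\<^sup>2))"
    by (intro Bochner_Integration.integral_cong refl)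
       (simp add: power2_sum int add_ac mult.assoc)
  also have "\<dots> = measure_pmf.expectation J (\<lambda>x. (g x)\<^sup>2) +
      measure_pmf.expectation ?P (\<lambda>w. (\<Sum>t\<in>A. g (w t))\<^sup>2)"
    by (simp add: int zero)
  finally show ?case using insert by (simp add: algebra_simps)
qed simp

text \<open>Chebyshev's inequality. The deviation is measured on the sum and not on the mean, so
  that it can also be set to 1, to exclude a single occurrence.\<close>

lemma weak_law_Pi_pmf:
  fixes g :: "'a \<Rightarrow> real"
  assumes "finite A" "finite (set_pmf J)" "\<delta> > 0"
  defines "\<mu> \<equiv> measure_pmf.expectation J g"
  shows "measure_pmf.prob (Pi_pmf A d (\<lambda>_. J)) {w. \<bar>(\<Sum>t\<in>A. g (w t)) - real (card A) * \<mu>\<bar> \<ge> \<delta>}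
    \<le> real (card A) * measure_pmf.expectation J (\<lambda>x. (g x - \<mu>)\<^sup>2) / \<delta>\<^sup>2"
proof -
  let ?P = "Pi_pmf A d (\<lambda>_. J)" and ?S = "\<lambda>w. (\<Sum>t\<in>A. g (w t) - \<mu>)"
  have fin: "finite (set_pmf ?P)" using assms by (intro finite_set_Pi_pmf)
  have S: "?S w = (\<Sum>t\<in>A. g (w t)) - real (card A) * \<mu>" for w by (simp add: sum_subtractf)
  have "measure_pmf.expectation J (\<lambda>x. g x - \<mu>) = 0"
    by (subst Bochner_Integration.integral_diff)
       (auto simp: \<mu>_def integrable_measure_pmf_finite[OF assms(2)])
  then have var: "measure_pmf.expectation ?P (\<lambda>w. (?S w)\<^sup>2 / \<delta>\<^sup>2) =
      real (card A) * measure_pmf.expectation J (\<lambda>x. (g x - \<mu>)\<^sup>2) / \<delta>\<^sup>2"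
    using expectation_sum_square_Pi_pmf[OF assms(1,2), where g = "\<lambda>x. g x - \<mu>" and d = d]
    by (simp only: integral_divide_zero)
  have "measure_pmf.prob ?P {w. \<bar>?S w\<bar> \<ge> \<delta>} =
      measure_pmf.expectation ?P (indicator {w. \<bar>?S w\<bar> \<ge> \<delta>})"
    by simp
  also have "\<dots> \<le> measure_pmf.expectation ?P (\<lambda>w. (?S w)\<^sup>2 / \<delta>\<^sup>2)"
  proof (rule expectation_pmf_mono[OF fin])
    fix w
    show "indicator {w. \<bar>?S w\<bar> \<ge> \<delta>} w \<le> (?S w)\<^sup>2 / \<delta>\<^sup>2"
      using abs_le_square_iff[of \<delta> "?S w"] \<open>\<delta> > 0\<close> by (auto simp: indicator_def)
  qed
  also note var
  finally show ?thesis by (simp add: S)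
qed

section \<open>Reduction to a single additional codeword\<close>

definition row_pmf :: "nat \<Rightarrow> real \<Rightarrow> (nat \<Rightarrow> bool) pmf" where
  "row_pmf T p = Pi_pmf {1..T} False (\<lambda>_. bernoulli_pmf p)"

definition context_pmf ::
  "nat \<Rightarrow> real \<Rightarrow> real \<Rightarrow> real \<Rightarrow> ((nat \<Rightarrow> bool) \<times> (nat \<Rightarrow> bool) \<times> (nat \<Rightarrow> bool)) pmf" where
  "context_pmf T p q10 q01 = do {
     x1 \<leftarrow> row_pmf T p;
     x2 \<leftarrow> row_pmf T p;
     y \<leftarrow> channel_pmf T q10 q01 (vec_or x1 x2);
     return_pmf (x1, x2, y)}"

text \<open>A further user with such a codeword is joined to both active users, so it closes a
  triangle as soon as {1, 2} is an edge.\<close>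

definition confusable ::
  "real \<Rightarrow> real \<Rightarrow> real \<Rightarrow> real \<Rightarrow> nat \<Rightarrow> (nat \<Rightarrow> bool) \<times> (nat \<Rightarrow> bool) \<times> (nat \<Rightarrow> bool) \<Rightarrow> (nat \<Rightarrow> bool) set" where
  "confusable p q10 q01 \<epsilon> T = (\<lambda>(x1, x2, y).
     {s. (y, vec_or x1 s) \<in> typical_set p q10 q01 \<epsilon> T \<and> (y, vec_or x2 s) \<in> typical_set p q10 q01 \<epsilon> T})"

definition true_edge ::
  "real \<Rightarrow> real \<Rightarrow> real \<Rightarrow> real \<Rightarrow> nat \<Rightarrow> (nat \<Rightarrow> bool) \<times> (nat \<Rightarrow> bool) \<times> (nat \<Rightarrow> bool) \<Rightarrow> bool" where
  "true_edge p q10 q01 \<epsilon> T = (\<lambda>(x1, x2, y). (y, vec_or x1 x2) \<in> typical_set p q10 q01 \<epsilon> T)"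

lemma finite_row_pmf [simp]: "finite (set_pmf (row_pmf T p))"
  unfolding row_pmf_def by (intro finite_set_Pi_pmf) auto

lemma finite_channel_pmf [simp]: "finite (set_pmf (channel_pmf T q10 q01 y0))"
  unfolding channel_pmf_def by (intro finite_set_Pi_pmf) auto

lemma finite_context_pmf [simp]: "finite (set_pmf (context_pmf T p q10 q01))"
  unfolding context_pmf_def by auto

lemma matrix_pmf_conv_rows:
  "matrix_pmf N T p =
     map_pmf (\<lambda>g (i, t). g i t) (Pi_pmf {1..N} (\<lambda>_. False) (\<lambda>_. row_pmf T p))"
  unfolding matrix_pmf_def row_pmf_def by (subst Pi_pmf_Times) (auto simp: case_prod_unfold)

text \<open>The channel only sees rows 1 and 2, so its output can be drawn before the other rows.
  These are then i.i.d. and independent of the context.\<close>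

lemma system_pmf_conv_context:
  assumes "N \<ge> 2"
  shows "system_pmf N T p q10 q01 = do {
    (x1, x2, y) \<leftarrow> context_pmf T p q10 q01;
    f \<leftarrow> Pi_pmf {3..N} (\<lambda>_. False) (\<lambda>_. row_pmf T p);
    return_pmf ((\<lambda>(i, t). (f(2 := x2, 1 := x1)) i t), y)}"
proof -
  have N: "{1..N} = insert 1 (insert 2 {3..N})" using assms by auto
  have upd: "(f(2 := b, 1 := a)) 1 = a" "(f(2 := b, 1 := a)) 2 = b"
    for f :: "nat \<Rightarrow> nat \<Rightarrow> bool" and a b by auto
  have cw: "codeword (\<lambda>(i, t). g i t) i = g i" for g i by (simp add: codeword_def)
  have "system_pmf N T p q10 q01 = do {
    x1 \<leftarrow> row_pmf T p;
    x2 \<leftarrow> row_pmf T p;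
    f \<leftarrow> Pi_pmf {3..N} (\<lambda>_. False) (\<lambda>_. row_pmf T p);
    y \<leftarrow> channel_pmf T q10 q01 (vec_or x1 x2);
    return_pmf ((\<lambda>(i, t). (f(2 := x2, 1 := x1)) i t), y)}"
    unfolding system_pmf_def matrix_pmf_conv_rows N
    by (simp add: Pi_pmf_insert' bind_map_pmf bind_assoc_pmf bind_return_pmf cw upd map_pmf_def
      del: fun_upd_apply One_nat_def)
  also have "\<dots> = do {
    x1 \<leftarrow> row_pmf T p;
    x2 \<leftarrow> row_pmf T p;
    y \<leftarrow> channel_pmf T q10 q01 (vec_or x1 x2);
    f \<leftarrow> Pi_pmf {3..N} (\<lambda>_. False) (\<lambda>_. row_pmf T p);
    return_pmf ((\<lambda>(i, t). (f(2 := x2, 1 := x1)) i t), y)}"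
    by (intro bind_pmf_cong refl) (rule bind_commute_pmf)
  finally show ?thesis
    by (simp add: context_pmf_def bind_assoc_pmf bind_return_pmf)
qed

lemma one_odd_cycle_triangle:
  assumes "{1, 2} \<in> E" "{1, i} \<in> E" "{2, i} \<in> E" "i \<noteq> 1" "i \<noteq> 2"
  shows "one_odd_cycle E [1, 2, i]"
proof -
  have *: "{k. k < length [1, 2, i]} = {0, Suc 0, Suc (Suc 0)}" by auto
  have "cycle_edges [1, 2, i] = (\<lambda>k. {[1, 2, i] ! k, [1, 2, i] ! (Suc k mod length [1, 2, i])}) `
      {k. k < length [1, 2, i]}"
    unfolding cycle_edges_def by (rule setcompr_eq_image)
  then have "cycle_edges [1, 2, i] = {{1, 2}, {2, i}, {i, 1}}" unfolding * by simp
  then show ?thesis using assms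
    by (auto simp: one_odd_cycle_def is_cycle_def insert_commute)
qed

text \<open>Failure requires the edge {1, 2} and no confusable codeword among the users 3 to
  \<open>N\<close>. Given the context these \<open>N - 2\<close> codewords are independent, whence
  the power.\<close>

lemma one_minus_P3_le:
  assumes "N \<ge> 2"
  shows "1 - P3 p q10 q01 \<epsilon> N T \<le> measure_pmf.expectation (context_pmf T p q10 q01)
    (\<lambda>z. of_bool (true_edge p q10 q01 \<epsilon> T z) *
       (1 - measure_pmf.prob (row_pmf T p) (confusable p q10 q01 \<epsilon> T z)) ^ (N - 2))"
proof -
  let ?S = "system_pmf N T p q10 q01" and ?conf = "confusable p q10 q01 \<epsilon> T"
    and ?rest = "Pi_pmf {3..N} (\<lambda>_. False) (\<lambda>_. row_pmf T p)"
  define B where "B = {(X, y). let z = (codeword X 1, codeword X 2, y)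
    in true_edge p q10 q01 \<epsilon> T z \<and> (\<forall>i\<in>{3..N}. codeword X i \<notin> ?conf z)}"
  define A where "A = {(X, y). (\<exists>c. one_odd_cycle (decoding_graph p q10 q01 \<epsilon> N T X y) c \<and> length c = 3) \<or>
                {1, 2} \<notin> decoding_graph p q10 q01 \<epsilon> N T X y}"
  have sub: "- A \<subseteq> B"
  proof
    fix \<omega> assume "\<omega> \<in> - A"
    then obtain X y where \<omega>: "\<omega> = (X, y)"
      and no: "\<not> (\<exists>c. one_odd_cycle (decoding_graph p q10 q01 \<epsilon> N T X y) c \<and> length c = 3)"
      and edge: "{1, 2} \<in> decoding_graph p q10 q01 \<epsilon> N T X y"
      by (auto simp: A_def)
    have comm: "vec_or u v = vec_or v u" for u v by (auto simp: vec_or_def)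
    have "true_edge p q10 q01 \<epsilon> T (codeword X 1, codeword X 2, y)"
      using edge comm[of "codeword X 1"]
      by (auto simp: decoding_graph_def true_edge_def doubleton_eq_iff)
    moreover have "codeword X i \<notin> ?conf (codeword X 1, codeword X 2, y)" if i: "i \<in> {3..N}" for i
    proof
      assume *: "codeword X i \<in> ?conf (codeword X 1, codeword X 2, y)"
      have "{1, i} \<in> decoding_graph p q10 q01 \<epsilon> N T X y"
        unfolding decoding_graph_def using * i assms
        by (intro CollectI exI[of _ 1] exI[of _ i]) (auto simp: confusable_def)
      moreover have "{2, i} \<in> decoding_graph p q10 q01 \<epsilon> N T X y"
        unfolding decoding_graph_def using * i assms
        by (intro CollectI exI[of _ 2] exI[of _ i]) (auto simp: confusable_def)
      ultimately have "one_odd_cycle (decoding_graph p q10 q01 \<epsilon> N T X y) [1, 2, i]"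
        using edge i by (intro one_odd_cycle_triangle) auto
      with no show False by force
    qed
    ultimately show "\<omega> \<in> B" by (simp add: B_def \<omega> Let_def)
  qed
  have fin: "finite (set_pmf ?rest)" by (intro finite_set_Pi_pmf) auto
  have prob: "measure_pmf.prob ?rest (Pi {3..N} (\<lambda>_. - ?conf z)) =
      (1 - measure_pmf.prob (row_pmf T p) (?conf z)) ^ (N - 2)" for z
  proof -
    have "card {3..N} = N - 2" by simp
    then show ?thesis
      using measure_pmf.prob_compl[of "?conf z" "row_pmf T p"]
      by (simp add: measure_Pi_pmf_Pi Compl_eq_Diff_UNIV del: card_atLeastAtMost)
  qed
  have "1 - P3 p q10 q01 \<epsilon> N T = measure_pmf.prob ?S (- A)"
    using measure_pmf.prob_compl[of A ?S] by (simp add: P3_def A_def Compl_eq_Diff_UNIV)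
  also have "\<dots> \<le> measure_pmf.prob ?S B"
    by (rule measure_pmf.finite_measure_mono[OF sub]) simp
  also have "\<dots> = measure_pmf.expectation ?S (indicator B)" by simp
  also have "\<dots> = measure_pmf.expectation (context_pmf T p q10 q01) (\<lambda>z.
      of_bool (true_edge p q10 q01 \<epsilon> T z) * measure_pmf.prob ?rest (Pi {3..N} (\<lambda>_. - ?conf z)))"
    unfolding system_pmf_conv_context[OF assms]
  proof (subst expectation_bind_pmf_finite, goal_cases)
    case 3
    show ?case
    proof (intro Bochner_Integration.integral_cong refl)
      fix z :: "(nat \<Rightarrow> bool) \<times> (nat \<Rightarrow> bool) \<times> (nat \<Rightarrow> bool)"
      obtain x1 x2 y where z: "z = (x1, x2, y)" by (cases z)
      let ?g = "\<lambda>f. ((\<lambda>(i, t). (f(2 := x2, 1 := x1)) i t), y)"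
      \<comment> \<open>For a fixed context the edge condition is constant, and the rest of
        \<open>B\<close> is a product event in the remaining rows.\<close>
      have "?g -` B = (if true_edge p q10 q01 \<epsilon> T z then Pi {3..N} (\<lambda>_. - ?conf z) else {})"
        by (auto simp: B_def z codeword_def Pi_def)
      then show "measure_pmf.expectation (case z of (x1, x2, y) \<Rightarrow>
            ?rest \<bind> (\<lambda>f. return_pmf ((\<lambda>(i, t). (f(2 := x2, 1 := x1)) i t), y))) (indicator B) =
          of_bool (true_edge p q10 q01 \<epsilon> T z) * measure_pmf.prob ?rest (Pi {3..N} (\<lambda>_. - ?conf z))"
        by (simp add: z map_pmf_def[symmetric] del: fun_upd_apply One_nat_def)
    qed
  qed (use fin in \<open>auto simp: case_prod_unfold\<close>)
  finally show ?thesis by (simp only: prob)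
qed

section \<open>Change of measure\<close>

text \<open>The joint law of one round, with \<open>s\<close> the redrawn bit. The tuple is ordered
  \<open>(u, v, w, s)\<close>, whereas \<open>\<gamma>\<close> takes the output \<open>w\<close>
  first.\<close>

definition round_pmf ::
  "real \<Rightarrow> real \<Rightarrow> real \<Rightarrow> (bool \<Rightarrow> bool \<Rightarrow> bool \<Rightarrow> real) \<Rightarrow> (bool \<times> bool \<times> bool \<times> bool) pmf" where
  "round_pmf p q10 q01 \<gamma> = do {
     u \<leftarrow> bernoulli_pmf p;
     v \<leftarrow> bernoulli_pmf p;
     w \<leftarrow> bernoulli_pmf (p_chan q10 q01 True (u \<or> v));
     s \<leftarrow> bernoulli_pmf (\<gamma> w u v);
     return_pmf (u, v, w, s)}"

definition tilted_pmf ::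
  "nat \<Rightarrow> (bool \<Rightarrow> bool \<Rightarrow> bool \<Rightarrow> real) \<Rightarrow> (nat \<Rightarrow> bool) \<times> (nat \<Rightarrow> bool) \<times> (nat \<Rightarrow> bool) \<Rightarrow> (nat \<Rightarrow> bool) pmf" where
  "tilted_pmf T \<gamma> = (\<lambda>(x1, x2, y). Pi_pmf {1..T} False (\<lambda>t. bernoulli_pmf (\<gamma> (y t) (x1 t) (x2 t))))"

lemma finite_tilted_pmf [simp]: "finite (set_pmf (tilted_pmf T \<gamma> z))"
  unfolding tilted_pmf_def by (cases z) (auto intro!: finite_set_Pi_pmf)

text \<open>The tilt acts round by round, so a context and its tilted codeword together form
  \<open>T\<close> i.i.d. rounds. This makes the weak law applicable.\<close>

lemma Pi_pmf_round_pmf: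
  "Pi_pmf {1..T} d (\<lambda>_. round_pmf p q10 q01 \<gamma>) = do {
     (x1, x2, y) \<leftarrow> context_pmf T p q10 q01;
     s \<leftarrow> tilted_pmf T \<gamma> (x1, x2, y);
     return_pmf (\<lambda>t. if t \<in> {1..T} then (x1 t, x2 t, y t, s t) else d)}"
  unfolding round_pmf_def
  by (simp add: Pi_pmf_bind[where d' = False] context_pmf_def bind_assoc_pmf bind_return_pmf
      row_pmf_def channel_pmf_def tilted_pmf_def vec_or_def)

lemma expectation_context_tilted:
  fixes h :: "bool \<times> bool \<times> bool \<times> bool \<Rightarrow> real"
  shows "measure_pmf.expectation (context_pmf T p q10 q01) (\<lambda>(x1, x2, y).
      measure_pmf.prob (tilted_pmf T \<gamma> (x1, x2, y)) {s. P (\<Sum>t\<in>{1..T}. h (x1 t, x2 t, y t, s t))}) =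
    measure_pmf.prob (Pi_pmf {1..T} d (\<lambda>_. round_pmf p q10 q01 \<gamma>)) {\<omega>. P (\<Sum>t\<in>{1..T}. h (\<omega> t))}"
proof -
  let ?A = "{\<omega>. P (\<Sum>t\<in>{1..T}. h (\<omega> t))}"
  have "measure_pmf.prob (Pi_pmf {1..T} d (\<lambda>_. round_pmf p q10 q01 \<gamma>)) ?A =
    measure_pmf.expectation (Pi_pmf {1..T} d (\<lambda>_. round_pmf p q10 q01 \<gamma>)) (indicator ?A)" by simp
  also have "\<dots> = measure_pmf.expectation (context_pmf T p q10 q01) (\<lambda>(x1, x2, y).
      measure_pmf.prob (tilted_pmf T \<gamma> (x1, x2, y)) {s. P (\<Sum>t\<in>{1..T}. h (x1 t, x2 t, y t, s t))})"
    unfolding Pi_pmf_round_pmf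
  proof (subst expectation_bind_pmf_finite, goal_cases)
    case 3
    show ?case
    proof (intro Bochner_Integration.integral_cong refl)
      fix z :: "(nat \<Rightarrow> bool) \<times> (nat \<Rightarrow> bool) \<times> (nat \<Rightarrow> bool)"
      obtain x1 x2 y where z: "z = (x1, x2, y)" by (cases z)
      let ?g = "\<lambda>s t. if t \<in> {1..T} then (x1 t, x2 t, y t, s t) else d"
      have "?g -` ?A = {s. P (\<Sum>t\<in>{1..T}. h (x1 t, x2 t, y t, s t))}"
      proof -
        have "(\<Sum>t\<in>{1..T}. h (?g s t)) = (\<Sum>t\<in>{1..T}. h (x1 t, x2 t, y t, s t))" for s
          by (intro sum.cong) auto
        then show ?thesis by (simp only: vimage_Collect_eq mem_Collect_eq)
      qed
      then show "measure_pmf.expectation (case z of (x1, x2, y) \<Rightarrow> tilted_pmf T \<gamma> (x1, x2, y) \<bind>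
            (\<lambda>s. return_pmf (\<lambda>t. if t \<in> {1..T} then (x1 t, x2 t, y t, s t) else d))) (indicator ?A) =
          (case z of (x1, x2, y) \<Rightarrow> measure_pmf.prob (tilted_pmf T \<gamma> (x1, x2, y))
            {s. P (\<Sum>t\<in>{1..T}. h (x1 t, x2 t, y t, s t))})"
        by (simp add: z map_pmf_def[symmetric])
    qed
  qed (auto simp: case_prod_unfold)
  finally show ?thesis by simp
qed

lemma expectation_round_pmf:
  fixes h :: "bool \<times> bool \<times> bool \<times> bool \<Rightarrow> real"
  assumes "p \<in> {0..1}" "q10 \<in> {0..1}" "q01 \<in> {0..1}" "\<And>w u v. \<gamma> w u v \<in> {0..1}"
  shows "measure_pmf.expectation (round_pmf p q10 q01 \<gamma>) h =
    (\<Sum>u\<in>UNIV. \<Sum>v\<in>UNIV. \<Sum>w\<in>UNIV. \<Sum>s\<in>UNIV. p_yxx p q10 q01 w u v * px (\<gamma> w u v) s * h (u, v, w, s))"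
proof -
  have [simp]: "0 \<le> \<gamma> w u v" "\<gamma> w u v \<le> 1" for w u v using assms(4) by auto
  show ?thesis using assms(1-3)
    by (simp add: round_pmf_def expectation_bind_pmf_finite UNIV_bool p_yxx_def px_def p_chan_def algebra_simps)
qed

lemma finite_round_pmf [simp]: "finite (set_pmf (round_pmf p q10 q01 \<gamma>))"
  by (rule finite_subset[of _ UNIV]) auto

text \<open>The weak law for the joint rounds, written as an average over contexts of conditional
  probabilities. In this form it bounds the share of bad contexts.\<close>

lemma tilted_weak_law:
  fixes h :: "bool \<times> bool \<times> bool \<times> bool \<Rightarrow> real" and p q10 q01 and \<gamma>
  assumes "\<delta> > 0"
  defines "\<mu> \<equiv> measure_pmf.expectation (round_pmf p q10 q01 \<gamma>) h"
  shows "measure_pmf.expectation (context_pmf T p q10 q01) (\<lambda>(x1, x2, y).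
      measure_pmf.prob (tilted_pmf T \<gamma> (x1, x2, y))
        {s. \<delta> \<le> \<bar>(\<Sum>t\<in>{1..T}. h (x1 t, x2 t, y t, s t)) - real T * \<mu>\<bar>})
    \<le> real T * measure_pmf.expectation (round_pmf p q10 q01 \<gamma>) (\<lambda>x. (h x - \<mu>)\<^sup>2) / \<delta>\<^sup>2"
  using weak_law_Pi_pmf[OF finite_atLeastAtMost[of 1 T] finite_round_pmf assms(1), of undefined p q10 q01 \<gamma> h]
    expectation_context_tilted[where P = "\<lambda>S. \<delta> \<le> \<bar>S - real T * \<mu>\<bar>" and d = undefined and h = h]
  by (simp add: \<mu>_def)

text \<open>Both supports are finite, so the comparison of masses on \<open>G\<close> can be
  summed.\<close>

lemma prob_change_of_measure:
  assumes "finite (set_pmf Q)" "finite (set_pmf R)" "\<And>s. s \<in> G \<Longrightarrow> c * pmf Q s \<le> pmf R s"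
  shows "c * measure_pmf.prob Q G \<le> measure_pmf.prob R G"
proof -
  let ?A = "set_pmf Q \<union> set_pmf R"
  have *: "measure_pmf.prob M G = (\<Sum>s\<in>?A. pmf M s * indicator G s)" if "set_pmf M \<subseteq> ?A" for M
  proof -
    have "measure_pmf.prob M G = measure_pmf.expectation M (indicator G)" by simp
    also have "\<dots> = (\<Sum>s\<in>?A. pmf M s * indicator G s)"
      using assms that by (subst integral_measure_pmf[where A = ?A]) auto
    finally show ?thesis .
  qed
  show ?thesis
    by (auto simp: * sum_distrib_left indicator_def intro!: sum_mono assms(3))
qed

text \<open>
  Where the tilted probability vanishes, \<open>ln 0 = 0\<close> makes the summand meaningless, but then the
  left-hand side is 0.
\<close>

lemma tilted_likelihood_ratio:
  assumes p: "0 < p" "p < 1" and \<gamma>: "\<And>w u v. \<gamma> w u v \<in> {0..1}"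
    and le: "(\<Sum>t\<in>{1..T}. ln (px (\<gamma> (y t) (x1 t) (x2 t)) (s t) / px p (s t))) \<le> M"
  shows "exp (- M) * pmf (tilted_pmf T \<gamma> (x1, x2, y)) s \<le> pmf (row_pmf T p) s"
proof (cases "\<forall>t. t \<notin> {1..T} \<longrightarrow> s t = False")
  case True
  let ?q = "\<lambda>t. px (\<gamma> (y t) (x1 t) (x2 t)) (s t)" and ?r = "\<lambda>t. px p (s t)"
  have bern: "pmf (bernoulli_pmf a) b = px a b" if "a \<in> {0..1}" for a b
    using that by (cases b) (auto simp: px_def)
  have q: "pmf (tilted_pmf T \<gamma> (x1, x2, y)) s = (\<Prod>t\<in>{1..T}. ?q t)"
    using True \<gamma> by (simp add: tilted_pmf_def pmf_Pi bern)
  have r: "pmf (row_pmf T p) s = (\<Prod>t\<in>{1..T}. ?r t)"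
    using True p by (simp add: row_pmf_def pmf_Pi bern)
  have rpos: "?r t > 0" for t using p by (auto simp: px_def)
  have qpos: "?q t \<ge> 0" for t using \<gamma>[of "y t" "x1 t" "x2 t"] by (auto simp: px_def)
  have "exp (- M) * (\<Prod>t\<in>{1..T}. ?q t) \<le> exp (- (\<Sum>t\<in>{1..T}. ln (?q t / ?r t))) * (\<Prod>t\<in>{1..T}. ?q t)"
    using le qpos by (intro mult_right_mono prod_nonneg) auto
  also have "\<dots> = (\<Prod>t\<in>{1..T}. exp (- ln (?q t / ?r t)) * ?q t)"
    by (simp add: exp_sum sum_negf[symmetric] prod.distrib)
  also have "\<dots> \<le> (\<Prod>t\<in>{1..T}. ?r t)"
  proof (intro prod_mono conjI)
    fix t
    show "0 \<le> exp (- ln (?q t / ?r t)) * ?q t" using qpos by simp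
    show "exp (- ln (?q t / ?r t)) * ?q t \<le> ?r t"
      using qpos[of t] rpos[of t] by (cases "?q t = 0") (auto simp: exp_minus)
  qed
  finally show ?thesis by (simp add: q r)
next
  case False
  then have "pmf (tilted_pmf T \<gamma> (x1, x2, y)) s = 0"
    by (auto simp: tilted_pmf_def pmf_Pi)
  then show ?thesis by simp
qed

section \<open>The optimal tilt\<close>

text \<open>The relative entropy of Bernoulli(\<open>r\<close>) with respect to
  Bernoulli(\<open>p\<close>). For \<open>r = 0\<close> or \<open>r = 1\<close> the vanishing factor
  realises the convention 0 log 0 = 0.\<close>

definition bernoulli_kl :: "real \<Rightarrow> real \<Rightarrow> real" where
  "bernoulli_kl r p = r * ln (r / p) + (1 - r) * ln ((1 - r) / (1 - p))"

lemma ln_ratio_eq: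
  fixes p l :: real
  assumes "0 < p" "p < 1"
  shows "ln (exp (2 * l) / (p + (1 - p) * exp (2 * l))) = 2 * l - ln (p + (1 - p) * exp (2 * l))"
proof -
  have "p + (1 - p) * exp (2 * l) > 0" using assms by (intro add_pos_nonneg) auto
  then show ?thesis by (simp add: ln_div)
qed

text \<open>
  \<open>r1\<close> and \<open>r2\<close> are the probabilities of a 1 in rounds with \<open>(x\<^sub>1, x\<^sub>2) = (0, 0)\<close> and in rounds with
  \<open>x\<^sub>1 \<noteq> x\<^sub>2\<close>.  If \<open>a = 0\<close> or \<open>b = 0\<close>, the supremum is only approached as \<open>l\<close> tends to
  \<open>\<plusminus>\<infinity>\<close>, and the tilt is the corresponding degenerate limit.
\<close>

lemma optimal_tilt:
  fixes a b p :: real and F :: "real \<Rightarrow> real"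
  assumes p: "0 < p" "p < 1" and ab: "a \<ge> 0" "b \<ge> 0"
    and F: "\<And>l. F l = a * ln (exp (2 * l) / (p + (1 - p) * exp (2 * l))) - 2 * b * ln (p + (1 - p) * exp l)"
    and bdd: "bdd_above (range F)"
  obtains r1 r2 where "r1 \<in> {0..1}" "r2 \<in> {0..1}" "a * (1 - r1) + b * (1 - r2) = a"
    "a * bernoulli_kl r1 p + 2 * b * bernoulli_kl r2 p \<le> (SUP l. F l)"
proof -
  have le: "F l \<le> (SUP l. F l)" for l using bdd by (intro cSUP_upper) auto
  consider "a = 0" | "b = 0" | "a > 0" "b > 0" using ab by force
  then show thesis
  proof cases
    case 1
    have "(F \<longlongrightarrow> - 2 * b * ln p) at_bot"
    proof -
      have "((\<lambda>l. p + (1 - p) * exp l) \<longlongrightarrow> p + (1 - p) * 0) at_bot"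
        by (intro tendsto_intros exp_at_bot)
      then have "((\<lambda>l. ln (p + (1 - p) * exp l)) \<longlongrightarrow> ln p) at_bot"
        using p by (intro tendsto_ln) auto
      then have "((\<lambda>l. - 2 * b * ln (p + (1 - p) * exp l)) \<longlongrightarrow> - 2 * b * ln p) at_bot"
        by (rule tendsto_mult_left)
      then show ?thesis using 1 by (simp add: F[abs_def])
    qed
    then have "- 2 * b * ln p \<le> (SUP l. F l)"
      by (rule tendsto_upperbound) (auto simp: le)
    \<comment> \<open>With \<open>a = 0\<close> the moment condition is
      \<open>b * (1 - r2) = 0\<close>. It is met by \<open>r2 = 1\<close>, whose entropy is
      \<open>- ln p\<close>.\<close>
    then show thesis using 1 p that[of p 1] by (simp add: bernoulli_kl_def ln_div)
  next
    case 2
    have "((\<lambda>l. ln (exp (2 * l) / (p + (1 - p) * exp (2 * l)))) \<longlongrightarrow> ln (1 / (1 - p))) at_top"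
    proof (rule tendsto_ln)
      show "((\<lambda>l. exp (2 * l) / (p + (1 - p) * exp (2 * l))) \<longlongrightarrow> 1 / (1 - p)) at_top"
        using p by real_asymp (simp add: inverse_eq_divide)
    qed (use p in auto)
    then have "(F \<longlongrightarrow> a * ln (1 / (1 - p))) at_top"
      using 2 by (simp add: F[abs_def] tendsto_mult_left)
    then have "a * ln (1 / (1 - p)) \<le> (SUP l. F l)"
      by (rule tendsto_upperbound) (auto simp: le)
    \<comment> \<open>With \<open>b = 0\<close> the moment condition forces \<open>r1 = 0\<close>
      unless \<open>a = 0\<close>; the limit of \<open>F\<close> at infinity is \<open>a\<close>
      times its entropy.\<close>
    moreover have "bernoulli_kl 0 p = ln (1 / (1 - p))" by (simp add: bernoulli_kl_def)
    ultimately have "a * bernoulli_kl 0 p + 2 * b * bernoulli_kl p p \<le> (SUP l. F l)"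
      using 2 by simp
    then show thesis using 2 p that[of 0 p] by simp
  next
    case 3
    \<comment> \<open>With \<open>x = exp l\<close>, \<open>G x\<close> is a positive multiple of
      \<open>- F' l\<close>, the denominators being cleared. A positive zero of \<open>G\<close> is
      thus a stationary point of \<open>F\<close>.\<close>
    define G where "G = (\<lambda>x. b * (1 - p) * x * (p + (1 - p) * x\<^sup>2) - a * p * (p + (1 - p) * x))"
    \<comment> \<open>Chosen such that \<open>X \<ge> 1\<close> and
      \<open>a * p \<le> b * (1 - p)\<^sup>2 * X\<close>, which lets the cubic term of
      \<open>G\<close> dominate at \<open>X\<close>.\<close>
    define X where "X = 1 + a * p / (b * (1 - p)\<^sup>2)"
    have X1: "X \<ge> 1" using p 3 by (simp add: X_def)
    have "G 0 \<le> 0" using p 3 by (simp add: G_def)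
    moreover have "G X \<ge> 0"
    proof -
      have "a * p \<le> b * (1 - p)\<^sup>2 * X" using p 3 by (simp add: X_def field_simps)
      also have "\<dots> \<le> b * (1 - p)\<^sup>2 * X\<^sup>2"
        using p 3 X1 by (intro mult_left_mono) (auto simp: power2_eq_square)
      finally have 1: "a * p \<le> b * (1 - p)\<^sup>2 * X\<^sup>2" .
      have "p * (X - 1) \<ge> 0" using p X1 by simp
      then have "p + (1 - p) * X \<le> X" by (simp add: algebra_simps)
      then have "a * p * (p + (1 - p) * X) \<le> a * p * X"
        using p 3 by (intro mult_left_mono) auto
      also have "\<dots> \<le> b * (1 - p)\<^sup>2 * X\<^sup>2 * X" using 1 X1 by (intro mult_right_mono) auto
      also have "\<dots> \<le> b * (1 - p) * X * (p + (1 - p) * X\<^sup>2)"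
        using p 3 X1 by (simp add: algebra_simps power2_eq_square)
      finally show ?thesis by (simp add: G_def)
    qed
    moreover have "continuous_on {0..X} G" unfolding G_def by (intro continuous_intros)
    ultimately obtain x where x: "0 \<le> x" "G x = 0"
      using IVT'[of G 0 0 X] X1 by auto
    have "x \<noteq> 0" using x 3 p by (auto simp: G_def)
    then have x0: "x > 0" using x by simp
    define l where "l = ln x"
    have el: "exp l = x" "exp (2 * l) = x\<^sup>2"
      using x0 by (auto simp: l_def exp_double)
    define Z1 where "Z1 = p + (1 - p) * x"
    define Z2 where "Z2 = p + (1 - p) * x\<^sup>2"
    \<comment> \<open>Exponential tilting: the weight of a bit 0 is multiplied by
      \<open>exp (2 * l)\<close> in rounds (0, 0), where it keeps both disjunctions at 0, and by
      \<open>exp l\<close> in mixed rounds, where it keeps only one.\<close>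
    define r1 where "r1 = p / Z2"
    define r2 where "r2 = p / Z1"
    have Z: "Z1 > 0" "Z2 > 0" "p \<le> Z1" "p \<le> Z2" using p x0 by (auto simp: Z1_def Z2_def add_pos_nonneg)
    have r: "r1 \<in> {0..1}" "r2 \<in> {0..1}" using p Z by (auto simp: r1_def r2_def)
    have "1 - r1 = (Z2 - p) / Z2" using Z by (simp add: r1_def diff_divide_distrib)
    then have c1: "1 - r1 = (1 - p) * x\<^sup>2 / Z2" by (simp add: Z2_def)
    have "1 - r2 = (Z1 - p) / Z1" using Z by (simp add: r2_def diff_divide_distrib)
    then have c2: "1 - r2 = (1 - p) * x / Z1" by (simp add: Z1_def)
    \<comment> \<open>Stationarity; divided by \<open>Z1 * Z2\<close> it is the moment
      condition.\<close>
    have G0: "b * (1 - p) * x * Z2 = a * p * Z1" using x by (simp add: G_def Z1_def Z2_def)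
    have "b * (1 - r2) = a * r1"
      unfolding c2 r1_def using Z G0 by (simp add: field_simps)
    then have eq: "a * (1 - r1) + b * (1 - r2) = a" by (simp add: algebra_simps)
    have "r1 / p = 1 / Z2" "r2 / p = 1 / Z1" using p by (auto simp: r1_def r2_def)
    moreover have "(1 - r1) / (1 - p) = x\<^sup>2 / Z2" "(1 - r2) / (1 - p) = x / Z1"
      using p by (auto simp: c1 c2)
    ultimately have kl: "bernoulli_kl r1 p = (1 - r1) * (2 * l) - ln Z2"
      "bernoulli_kl r2 p = (1 - r2) * l - ln Z1"
      using Z x0 by (auto simp: bernoulli_kl_def ln_div l_def ln_realpow algebra_simps)
    \<comment> \<open>The moment condition replaces the factor of \<open>2 * l\<close> by
      \<open>a\<close>, which turns the entropy into the objective at \<open>l\<close>.\<close>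
    have "a * bernoulli_kl r1 p + 2 * b * bernoulli_kl r2 p =
        2 * l * (a * (1 - r1) + b * (1 - r2)) - a * ln Z2 - 2 * b * ln Z1"
      unfolding kl by (simp add: algebra_simps)
    also have "\<dots> = F l"
      unfolding eq F ln_ratio_eq[OF p] unfolding el Z1_def Z2_def by (simp add: right_diff_distrib)
    finally show thesis using that[OF r eq] le[of l] by simp
  qed
qed

section \<open>The exponent as a sum of suprema, and the case where it vanishes\<close>

lemma objective_0 [simp]: "objective p q10 q01 w 0 = 0"
  by (simp add: objective_def)

lemma Sup_objective_nonneg:
  assumes "p \<in> {0..1}" "q10 \<in> {0..1}" "q01 \<in> {0..1}"
  shows "0 \<le> (SUP l. objective p q10 q01 w l)"
  using cSUP_upper[of 0 UNIV "objective p q10 q01 w"] bdd_above_objective[OF assms] by simp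

text \<open>The factor \<open>p_out\<close> cancels. If it is 0, both channel probabilities of
  \<open>w\<close> vanish because \<open>0 < p < 1\<close>, so the objective is identically 0 and
  agrees with the convention.\<close>

lemma D_exp_eq:
  assumes p: "0 < p" "p < 1" and q: "q10 \<in> {0..1}" "q01 \<in> {0..1}"
  shows "D_exp p q10 q01 = (SUP l. objective p q10 q01 True l) + (SUP l. objective p q10 q01 False l)"
proof -
  have "p_out p q10 q01 w * phi' p q10 q01 w = (SUP l. objective p q10 q01 w l)" for w
  proof (cases "p_out p q10 q01 w = 0")
    case True
    have "p_out p q10 q01 w = p_chan q10 q01 w True * (1 - (1 - p)\<^sup>2) + p_chan q10 q01 w False * (1 - p)\<^sup>2"
      by (simp add: p_out_def p_out1_def p_chan_def algebra_simps)
    moreover have "(1 - p)\<^sup>2 > 0" "(1 - p)\<^sup>2 < 1" using p by (auto simp: power_less_one_iff)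
    moreover have "p_chan q10 q01 w True \<ge> 0" "p_chan q10 q01 w False \<ge> 0"
      using q by (auto simp: p_chan_def)
    ultimately have "p_chan q10 q01 w True = 0" "p_chan q10 q01 w False = 0"
      using True by (auto simp: add_nonneg_eq_0_iff)
    then have "objective p q10 q01 w l = 0" for l by (simp add: objective_def p_yxx_def)
    then show ?thesis using True by simp
  qed (simp add: phi'_def)
  then show ?thesis by (simp add: D_exp_def)
qed

text \<open>The objective is 0 at 0, which is then a maximum, so its derivative there vanishes. The
  resulting equation is the moment condition for the untilted law.\<close>

lemma objective_nonpos_imp_balanced:
  assumes p: "0 < p" "p < 1" and le: "\<And>l. objective p q10 q01 w l \<le> 0"
  shows "p_yxx p q10 q01 w False False * p = p_yxx p q10 q01 w True False * (1 - p)"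
proof -
  define a where "a = p_yxx p q10 q01 w False False"
  define b where "b = p_yxx p q10 q01 w True False"
  have obj: "objective p q10 q01 w = (\<lambda>l. a * (2 * l - ln (p + (1 - p) * exp (2 * l)))
    - 2 * b * ln (p + (1 - p) * exp l))"
    unfolding objective_def a_def b_def by (simp add: ln_ratio_eq[OF p] fun_eq_iff)
  have "((objective p q10 q01 w) has_real_derivative (a * (2 - 2 * (1 - p)) - 2 * b * (1 - p))) (at 0)"
    unfolding obj by (auto intro!: derivative_eq_intros)
  then have "a * (2 - 2 * (1 - p)) - 2 * b * (1 - p) = 0"
    by (rule DERIV_local_max[where d = 1]) (auto simp: le)
  then show ?thesis by (simp add: a_def b_def algebra_simps)
qed

section \<open>Typicality under the tilted law\<close>

text \<open>The equation gives \<open>(y, x1 \<or> s)\<close> the right mass at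
  \<open>(w, 0)\<close>; symmetry carries this over to \<open>x2 \<or> s\<close>. The mass at
  \<open>(w, 1)\<close> follows, since redrawing \<open>s\<close> keeps the law of
  \<open>y\<close>.\<close>

definition matched :: "real \<Rightarrow> real \<Rightarrow> real \<Rightarrow> (bool \<Rightarrow> bool \<Rightarrow> bool \<Rightarrow> real) \<Rightarrow> bool" where
  "matched p q10 q01 \<gamma> \<longleftrightarrow> (\<forall>w u v. \<gamma> w u v \<in> {0..1} \<and> \<gamma> w u v = \<gamma> w v u) \<and>
     (\<forall>w. p_yxx p q10 q01 w False False * (1 - \<gamma> w False False) +
          p_yxx p q10 q01 w False True * (1 - \<gamma> w False True) = p_yxx p q10 q01 w False False)"

definition log_ratio :: "real \<Rightarrow> (bool \<Rightarrow> bool \<Rightarrow> bool \<Rightarrow> real) \<Rightarrow> bool \<times> bool \<times> bool \<times> bool \<Rightarrow> real" where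
  "log_ratio p \<gamma> = (\<lambda>(u, v, w, s). ln (px (\<gamma> w u v) s / px p s))"

text \<open>The two outputs are treated separately by \<open>optimal_tilt\<close>, and the entropies
  add up to at most \<open>D_exp\<close>. For exponent 0 the untilted law is already matched, and
  its log ratio is identically 0 rather than only small on average.\<close>

lemma matched_tilt_exists:
  assumes p: "0 < p" "p < 1" and q: "q10 \<in> {0..1}" "q01 \<in> {0..1}"
  obtains \<gamma> where "matched p q10 q01 \<gamma>"
    "measure_pmf.expectation (round_pmf p q10 q01 \<gamma>) (log_ratio p \<gamma>) \<le> D_exp p q10 q01"
    "D_exp p q10 q01 = 0 \<Longrightarrow> \<gamma> = (\<lambda>_ _ _. p)"
proof (cases "D_exp p q10 q01 = 0")
  case True
  have p': "p \<in> {0..1}" using p by simp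
  \<comment> \<open>Two nonnegative suprema with sum 0.\<close>
  have "(SUP l. objective p q10 q01 w l) = 0" for w
    using True Sup_objective_nonneg[OF p' q] unfolding D_exp_eq[OF p q]
    by (cases w) (smt (verit))+
  then have "objective p q10 q01 w l \<le> 0" for w l
    using cSUP_upper[of l UNIV "objective p q10 q01 w"] bdd_above_objective[OF p' q] by simp
  then have "p_yxx p q10 q01 w False False * p = p_yxx p q10 q01 w False True * (1 - p)" for w
    using objective_nonpos_imp_balanced[OF p] by (simp add: p_yxx_def mult_ac)
  then have "matched p q10 q01 (\<lambda>_ _ _. p)" using p by (simp add: matched_def algebra_simps)
  moreover have "log_ratio p (\<lambda>_ _ _. p) = (\<lambda>_. 0)"
    using p by (auto simp: log_ratio_def px_def fun_eq_iff)
  ultimately show thesis using True that[of "\<lambda>_ _ _. p"] by simp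
next
  case False
  have p': "p \<in> {0..1}" using p by simp
  define a where "a w = p_yxx p q10 q01 w False False" for w
  define b where "b w = p_yxx p q10 q01 w True False" for w
  have "\<exists>r1 r2. r1 \<in> {0..1} \<and> r2 \<in> {0..1} \<and> a w * (1 - r1) + b w * (1 - r2) = a w \<and>
      a w * bernoulli_kl r1 p + 2 * b w * bernoulli_kl r2 p \<le> (SUP l. objective p q10 q01 w l)" for w
  proof -
    have "a w \<ge> 0" "b w \<ge> 0" using p q by (auto simp: a_def b_def p_yxx_def px_def p_chan_def)
    then show ?thesis
      by (rule optimal_tilt[OF p _ _ _ bdd_above_objective[OF p' q, of w]])
         (auto simp: objective_def a_def b_def)
  qed
  then obtain r1 r2 where r: "\<And>w. r1 w \<in> {0..1}" "\<And>w. r2 w \<in> {0..1}"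
    and eq: "\<And>w. a w * (1 - r1 w) + b w * (1 - r2 w) = a w"
    and le: "\<And>w. a w * bernoulli_kl (r1 w) p + 2 * b w * bernoulli_kl (r2 w) p
        \<le> (SUP l. objective p q10 q01 w l)"
    by metis
  \<comment> \<open>In rounds (1, 1) both disjunctions are 1 whatever the bit is, so it keeps its
    law and costs no entropy.\<close>
  define \<gamma> where "\<gamma> = (\<lambda>w u v. if u \<and> v then p else if u \<or> v then r2 w else r1 w)"
  have \<gamma>: "\<gamma> w u v \<in> {0..1}" for w u v using r p' by (auto simp: \<gamma>_def)
  have b': "p_yxx p q10 q01 w False True = b w" for w by (simp add: b_def p_yxx_def)
  have "matched p q10 q01 \<gamma>"
    using \<gamma> eq by (auto simp: matched_def b' a_def[symmetric]) (auto simp: \<gamma>_def)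
  moreover have "measure_pmf.expectation (round_pmf p q10 q01 \<gamma>) (log_ratio p \<gamma>) =
      (a True * bernoulli_kl (r1 True) p + 2 * b True * bernoulli_kl (r2 True) p) +
      (a False * bernoulli_kl (r1 False) p + 2 * b False * bernoulli_kl (r2 False) p)"
    using p by (subst expectation_round_pmf[OF p' q \<gamma>])
      (simp add: UNIV_bool a_def[symmetric] b' b_def[symmetric] \<gamma>_def log_ratio_def px_def
         bernoulli_kl_def algebra_simps)
  ultimately show thesis
    using that[of \<gamma>] le[of True] le[of False] False unfolding D_exp_eq[OF p q] by linarith
qed

section \<open>Typicality as conditions on the counts of single symbols\<close>

definition typical_count ::
  "real \<Rightarrow> real \<Rightarrow> real \<Rightarrow> real \<Rightarrow> nat \<Rightarrow> bool \<Rightarrow> bool \<Rightarrow> real \<Rightarrow> bool" where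
  "typical_count p q10 q01 \<epsilon> T w w0 n \<longleftrightarrow>
     (p_yy0 p q10 q01 w w0 > 0 \<longrightarrow> \<bar>1 / real T * n - p_yy0 p q10 q01 w w0\<bar> \<le> \<epsilon> / 4) \<and>
     (p_yy0 p q10 q01 w w0 = 0 \<longrightarrow> n = 0)"

lemma occurrences_conv_sum:
  "real (occurrences T (w, w0) ys ys0) = (\<Sum>t\<in>{1..T}. of_bool (ys t = w \<and> ys0 t = w0))"
  by (simp add: occurrences_def of_bool_def sum.If_cases Int_def conj_commute)

lemma typical_set_conv_count:
  "(ys, ys0) \<in> typical_set p q10 q01 \<epsilon> T \<longleftrightarrow>
     (\<forall>w w0. typical_count p q10 q01 \<epsilon> T w w0 (\<Sum>t\<in>{1..T}. of_bool (ys t = w \<and> ys0 t = w0)))"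
  unfolding typical_count_def occurrences_conv_sum[symmetric] by (simp add: typical_set_def)

lemma typical_set_cong:
  assumes "\<And>t. t \<in> {1..T} \<Longrightarrow> v t = v' t"
  shows "(ys, v) \<in> typical_set p q10 q01 \<epsilon> T \<longleftrightarrow> (ys, v') \<in> typical_set p q10 q01 \<epsilon> T"
proof -
  have "(\<Sum>t\<in>{1..T}. of_bool (ys t = w \<and> v t = w0)) =
      (\<Sum>t\<in>{1..T}. of_bool (ys t = w \<and> v' t = w0) :: real)" for w w0
    using assms by (intro sum.cong) auto
  then show ?thesis unfolding typical_set_conv_count by (simp only:)
qed

text \<open>
  If the mean is 0, so is the variance, and the weak law with deviation 1 excludes even a single
  occurrence.
\<close>

lemma untypical_count_bound:
  fixes h :: "bool \<times> bool \<times> bool \<times> bool \<Rightarrow> bool"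
  assumes par: "p \<in> {0..1}" "q10 \<in> {0..1}" "q01 \<in> {0..1}" and "T > 0" "\<epsilon> > 0"
    and mean: "measure_pmf.expectation (round_pmf p q10 q01 \<gamma>) (\<lambda>x. of_bool (h x)) = p_yy0 p q10 q01 w w0"
  shows "measure_pmf.expectation (context_pmf T p q10 q01) (\<lambda>(x1, x2, y).
      measure_pmf.prob (tilted_pmf T \<gamma> (x1, x2, y))
        {s. \<not> typical_count p q10 q01 \<epsilon> T w w0 (\<Sum>t\<in>{1..T}. of_bool (h (x1 t, x2 t, y t, s t)))})
    \<le> 16 / (real T * \<epsilon>\<^sup>2)"
proof -
  let ?\<mu> = "p_yy0 p q10 q01 w w0" and ?J = "round_pmf p q10 q01 \<gamma>"
  let ?S = "\<lambda>x1 x2 y s. \<Sum>t\<in>{1..T}. of_bool (h (x1 t, x2 t, y t, s t)) :: real"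
  \<comment> \<open>The tolerance \<open>\<epsilon> / 4\<close> on the frequency becomes
    \<open>T * \<epsilon> / 4\<close> on the count.\<close>
  define \<delta> where "\<delta> = (if ?\<mu> = 0 then 1 else real T * \<epsilon> / 4)"
  have "(1 - p)\<^sup>2 \<le> 1" using par by (auto simp: power_le_one)
  then have \<mu>: "0 \<le> ?\<mu>" "?\<mu> \<le> 1"
    using par by (auto simp: p_yy0_def p_chan_def intro: mult_le_one)
  have \<delta>: "\<delta> > 0" using assms by (simp add: \<delta>_def)
  have sub: "{s. \<not> typical_count p q10 q01 \<epsilon> T w w0 (?S x1 x2 y s)} \<subseteq>
      {s. \<delta> \<le> \<bar>?S x1 x2 y s - real T * ?\<mu>\<bar>}" for x1 x2 y
  proof safe
    fix s assume *: "\<not> typical_count p q10 q01 \<epsilon> T w w0 (?S x1 x2 y s)"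
    show "\<delta> \<le> \<bar>?S x1 x2 y s - real T * ?\<mu>\<bar>"
    proof (cases "?\<mu> = 0")
      case True
      define n where "n = card {t\<in>{1..T}. h (x1 t, x2 t, y t, s t)}"
      have "?S x1 x2 y s = real n" by (simp add: n_def of_bool_def sum.If_cases Int_def)
      then show ?thesis using * True by (simp add: typical_count_def \<delta>_def)
    next
      case False
      then have "\<epsilon> / 4 < \<bar>1 / real T * ?S x1 x2 y s - ?\<mu>\<bar>"
        using * \<mu> by (simp add: typical_count_def)
      also have "1 / real T * ?S x1 x2 y s - ?\<mu> = (?S x1 x2 y s - real T * ?\<mu>) / real T"
        using \<open>T > 0\<close> by (simp add: diff_divide_distrib)
      also have "\<bar>\<dots>\<bar> = \<bar>?S x1 x2 y s - real T * ?\<mu>\<bar> / real T"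
        by (simp only: abs_divide abs_of_nat)
      finally show ?thesis using False \<open>T > 0\<close> by (simp add: \<delta>_def field_simps)
    qed
  qed
  have "measure_pmf.expectation (context_pmf T p q10 q01) (\<lambda>(x1, x2, y).
      measure_pmf.prob (tilted_pmf T \<gamma> (x1, x2, y))
        {s. \<not> typical_count p q10 q01 \<epsilon> T w w0 (?S x1 x2 y s)})
    \<le> measure_pmf.expectation (context_pmf T p q10 q01) (\<lambda>(x1, x2, y).
      measure_pmf.prob (tilted_pmf T \<gamma> (x1, x2, y)) {s. \<delta> \<le> \<bar>?S x1 x2 y s - real T * ?\<mu>\<bar>})"
    unfolding case_prod_unfold
    by (intro expectation_pmf_mono measure_pmf.finite_measure_mono sub) auto
  also have "\<dots> \<le> real T * measure_pmf.expectation ?J (\<lambda>x. (of_bool (h x) - ?\<mu>)\<^sup>2) / \<delta>\<^sup>2"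
    using tilted_weak_law[OF \<delta>, where h = "\<lambda>x. of_bool (h x)" and p = p and ?q10.0 = q10 and ?q01.0 = q01
        and \<gamma> = \<gamma> and T = T] unfolding mean .
  also have "\<dots> \<le> 16 / (real T * \<epsilon>\<^sup>2)"
  proof (cases "?\<mu> = 0")
    case True
    have "(\<lambda>x. (of_bool (h x) - ?\<mu>)\<^sup>2) = (\<lambda>x. of_bool (h x))" by (auto simp: True)
    then show ?thesis using mean True \<open>T > 0\<close> by simp
  next
    case False
    have "measure_pmf.expectation ?J (\<lambda>x. (of_bool (h x) - ?\<mu>)\<^sup>2) \<le> measure_pmf.expectation ?J (\<lambda>x. 1)"
      using \<mu> by (intro expectation_pmf_mono) (auto simp: abs_square_le_1 of_bool_def)
    then have "real T * measure_pmf.expectation ?J (\<lambda>x. (of_bool (h x) - ?\<mu>)\<^sup>2) / \<delta>\<^sup>2 \<le> real T / \<delta>\<^sup>2"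
      using \<open>T > 0\<close> by (intro divide_right_mono) (auto simp: mult_left_le)
    also have "\<dots> = 16 / (real T * \<epsilon>\<^sup>2)"
      using False \<open>T > 0\<close> by (simp add: \<delta>_def power2_eq_square field_simps)
    finally show ?thesis .
  qed
  finally show ?thesis .
qed

text \<open>For \<open>w0 = False\<close> this is the equation in \<open>matched\<close>, for the
  second user after exchanging \<open>u\<close> and \<open>v\<close>. For \<open>w0 = True\<close>
  it is the complement within the event \<open>y = w\<close>.\<close>

lemma matched_mean:
  assumes par: "p \<in> {0..1}" "q10 \<in> {0..1}" "q01 \<in> {0..1}" and m: "matched p q10 q01 \<gamma>"
  shows "measure_pmf.expectation (round_pmf p q10 q01 \<gamma>) (\<lambda>(u, v, w', s). of_bool (w' = w \<and> (u \<or> s) = w0))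
      = p_yy0 p q10 q01 w w0"
    and "measure_pmf.expectation (round_pmf p q10 q01 \<gamma>) (\<lambda>(u, v, w', s). of_bool (w' = w \<and> (v \<or> s) = w0))
      = p_yy0 p q10 q01 w w0"
proof -
  have \<gamma>: "\<gamma> w u v \<in> {0..1}" for w u v using m by (simp add: matched_def)
  have sym: "\<gamma> w True False = \<gamma> w False True" for w using m by (auto simp: matched_def)
  have eq: "p_yxx p q10 q01 w False False * (1 - \<gamma> w False False) +
          p_yxx p q10 q01 w False True * (1 - \<gamma> w False True) = p_yxx p q10 q01 w False False" for w
    using m by (simp add: matched_def)
  have comm: "p_yxx p q10 q01 w True False = p_yxx p q10 q01 w False True" for w by (simp add: p_yxx_def)
  have 0: "p_yy0 p q10 q01 w False = p_yxx p q10 q01 w False False" for w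
    by (simp add: p_yy0_def p_yxx_def px_def power2_eq_square)
  have 1: "p_yy0 p q10 q01 w True = 2 * p_yxx p q10 q01 w False True + p_yxx p q10 q01 w True True" for w
    by (simp add: p_yy0_def p_yxx_def px_def power2_eq_square algebra_simps)
  show "measure_pmf.expectation (round_pmf p q10 q01 \<gamma>) (\<lambda>(u, v, w', s). of_bool (w' = w \<and> (u \<or> s) = w0))
      = p_yy0 p q10 q01 w w0"
    using eq[of w] by (subst expectation_round_pmf[OF par \<gamma>], cases w; cases w0)
      (simp_all add: UNIV_bool 0 1 comm sym px_def algebra_simps)
  show "measure_pmf.expectation (round_pmf p q10 q01 \<gamma>) (\<lambda>(u, v, w', s). of_bool (w' = w \<and> (v \<or> s) = w0))
      = p_yy0 p q10 q01 w w0"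
    using eq[of w] by (subst expectation_round_pmf[OF par \<gamma>], cases w; cases w0)
      (simp_all add: UNIV_bool 0 1 comm sym px_def algebra_simps)
qed

section \<open>Bounds for fixed N and T\<close>

text \<open>A union bound over eight events, two active users times four symbols, each contributing
  \<open>16 / (T * \<epsilon>\<^sup>2)\<close>.\<close>

lemma confusable_whp:
  assumes par: "p \<in> {0..1}" "q10 \<in> {0..1}" "q01 \<in> {0..1}" and m: "matched p q10 q01 \<gamma>"
    and "T > 0" "\<epsilon> > 0"
  shows "measure_pmf.expectation (context_pmf T p q10 q01)
      (\<lambda>z. measure_pmf.prob (tilted_pmf T \<gamma> z) (- confusable p q10 q01 \<epsilon> T z))
    \<le> 128 / (real T * \<epsilon>\<^sup>2)"
proof -
  define h :: "bool \<times> bool \<times> bool \<Rightarrow> bool \<times> bool \<times> bool \<times> bool \<Rightarrow> bool" where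
    "h = (\<lambda>(j, w, w0) (u, v, w', s). w' = w \<and> ((if j then u else v) \<or> s) = w0)"
  define F where "F i = (\<lambda>(x1, x2, y). {s. \<not> typical_count p q10 q01 \<epsilon> T (fst (snd i)) (snd (snd i))
    (\<Sum>t\<in>{1..T}. of_bool (h i (x1 t, x2 t, y t, s t)))})" for i
  have F: "measure_pmf.expectation (context_pmf T p q10 q01)
      (\<lambda>z. measure_pmf.prob (tilted_pmf T \<gamma> z) (F i z)) \<le> 16 / (real T * \<epsilon>\<^sup>2)" for i
  proof -
    obtain j w w0 where i: "i = (j, w, w0)" by (cases i)
    have "measure_pmf.expectation (round_pmf p q10 q01 \<gamma>) (\<lambda>x. of_bool (h i x)) = p_yy0 p q10 q01 w w0"
      using matched_mean[OF par m, of w w0] by (cases j) (simp_all add: h_def i case_prod_unfold)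
    from untypical_count_bound[OF par \<open>T > 0\<close> \<open>\<epsilon> > 0\<close> this]
    show ?thesis by (simp add: F_def i case_prod_unfold)
  qed
  have sub: "- confusable p q10 q01 \<epsilon> T z \<subseteq> (\<Union>i. F i z)" for z
  proof
    fix s assume s: "s \<in> - confusable p q10 q01 \<epsilon> T z"
    obtain x1 x2 y where z: "z = (x1, x2, y)" by (cases z)
    consider w w0 where "s \<in> F (True, w, w0) z" | w w0 where "s \<in> F (False, w, w0) z"
      using s unfolding confusable_def z typical_set_conv_count F_def h_def vec_or_def by auto
    then show "s \<in> (\<Union>i. F i z)" by cases blast+
  qed
  have "measure_pmf.expectation (context_pmf T p q10 q01)
      (\<lambda>z. measure_pmf.prob (tilted_pmf T \<gamma> z) (- confusable p q10 q01 \<epsilon> T z))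
    \<le> measure_pmf.expectation (context_pmf T p q10 q01)
      (\<lambda>z. \<Sum>i\<in>UNIV. measure_pmf.prob (tilted_pmf T \<gamma> z) (F i z))"
  proof (rule expectation_pmf_mono)
    fix z
    have "measure_pmf.prob (tilted_pmf T \<gamma> z) (- confusable p q10 q01 \<epsilon> T z)
        \<le> measure_pmf.prob (tilted_pmf T \<gamma> z) (\<Union>i. F i z)"
      using sub by (intro measure_pmf.finite_measure_mono) auto
    also have "\<dots> \<le> (\<Sum>i\<in>UNIV. measure_pmf.prob (tilted_pmf T \<gamma> z) (F i z))"
      by (intro measure_pmf.finite_measure_subadditive_finite) auto
    finally show "measure_pmf.prob (tilted_pmf T \<gamma> z) (- confusable p q10 q01 \<epsilon> T z)
        \<le> (\<Sum>i\<in>UNIV. measure_pmf.prob (tilted_pmf T \<gamma> z) (F i z))" .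
  qed simp
  also have "\<dots> = (\<Sum>i\<in>UNIV. measure_pmf.expectation (context_pmf T p q10 q01)
      (\<lambda>z. measure_pmf.prob (tilted_pmf T \<gamma> z) (F i z)))"
    by (intro Bochner_Integration.integral_sum integrable_measure_pmf_finite) simp
  also have "\<dots> \<le> (\<Sum>i\<in>(UNIV :: (bool \<times> bool \<times> bool) set). 16 / (real T * \<epsilon>\<^sup>2))"
    by (intro sum_mono F)
  also have "card (UNIV :: (bool \<times> bool \<times> bool) set) = 8"
    by (simp add: card_UNIV_bool flip: UNIV_Times_UNIV)
  then have "(\<Sum>i\<in>(UNIV :: (bool \<times> bool \<times> bool) set). 16 / (real T * \<epsilon>\<^sup>2)) = 128 / (real T * \<epsilon>\<^sup>2)"
    by simp
  finally show ?thesis .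
qed

text \<open>For exponent 0 there is no slack \<open>\<delta>\<close>, since then \<open>T\<close> may grow faster than \<open>ln N\<close>.\<close>

definition threshold :: "real \<Rightarrow> real \<Rightarrow> nat \<Rightarrow> real" where
  "threshold D \<delta> T = (if D = 0 then 0 else real T * (D + \<delta>))"

text \<open>The cap on the log ratio limits the loss in the change of measure to the factor
  \<open>exp (- threshold)\<close>.\<close>

definition cheap_confusable where
  "cheap_confusable p q10 q01 \<epsilon> \<gamma> \<delta> T z = confusable p q10 q01 \<epsilon> T z \<inter>
     {s. case z of (x1, x2, y) \<Rightarrow>
       (\<Sum>t\<in>{1..T}. log_ratio p \<gamma> (x1 t, x2 t, y t, s t)) \<le> threshold (D_exp p q10 q01) \<delta> T}"

text \<open>The mean log ratio is at most the exponent, so exceeding the threshold is a deviation of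
  at least \<open>T * \<delta>\<close>. For exponent 0 the log ratio vanishes and the threshold 0 is
  never exceeded. Neither \<open>\<gamma>\<close> nor \<open>C\<close> depends on
  \<open>T\<close>.\<close>

lemma cheap_confusable_whp:
  assumes p: "0 < p" "p < 1" and q: "q10 \<in> {0..1}" "q01 \<in> {0..1}" and "\<epsilon> > 0" "\<delta> > 0"
  obtains \<gamma> C where "matched p q10 q01 \<gamma>"
    "\<And>T. T > 0 \<Longrightarrow> measure_pmf.expectation (context_pmf T p q10 q01)
      (\<lambda>z. measure_pmf.prob (tilted_pmf T \<gamma> z) (- cheap_confusable p q10 q01 \<epsilon> \<gamma> \<delta> T z)) \<le> C / real T"
proof -
  have par: "p \<in> {0..1}" using p by simp
  let ?D = "D_exp p q10 q01"
  obtain \<gamma> where m: "matched p q10 q01 \<gamma>"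
    and mean: "measure_pmf.expectation (round_pmf p q10 q01 \<gamma>) (log_ratio p \<gamma>) \<le> ?D"
    and D0: "?D = 0 \<Longrightarrow> \<gamma> = (\<lambda>_ _ _. p)"
    using matched_tilt_exists[OF p q] by metis
  define \<mu> where "\<mu> = measure_pmf.expectation (round_pmf p q10 q01 \<gamma>) (log_ratio p \<gamma>)"
  define V where "V = measure_pmf.expectation (round_pmf p q10 q01 \<gamma>) (\<lambda>x. (log_ratio p \<gamma> x - \<mu>)\<^sup>2)"
  define H where "H T = (\<lambda>(x1, x2, y). {s. threshold ?D \<delta> T <
      (\<Sum>t\<in>{1..T}. log_ratio p \<gamma> (x1 t, x2 t, y t, s t))})" for T
  have H: "measure_pmf.expectation (context_pmf T p q10 q01)
      (\<lambda>z. measure_pmf.prob (tilted_pmf T \<gamma> z) (H T z)) \<le> V / \<delta>\<^sup>2 / real T" if "T > 0" for T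
  proof (cases "?D = 0")
    case True
    have "log_ratio p \<gamma> x = 0" for x
      using p by (auto simp: D0[OF True] log_ratio_def px_def split: prod.split)
    then have "H T z = {}" for z by (auto simp: H_def True threshold_def)
    moreover have "V \<ge> 0" by (simp add: V_def)
    ultimately show ?thesis by simp
  next
    case False
    have "measure_pmf.expectation (context_pmf T p q10 q01)
      (\<lambda>z. measure_pmf.prob (tilted_pmf T \<gamma> z) (H T z)) \<le>
      measure_pmf.expectation (context_pmf T p q10 q01) (\<lambda>(x1, x2, y).
        measure_pmf.prob (tilted_pmf T \<gamma> (x1, x2, y))
        {s. real T * \<delta> \<le> \<bar>(\<Sum>t\<in>{1..T}. log_ratio p \<gamma> (x1 t, x2 t, y t, s t)) - real T * \<mu>\<bar>})"
    proof (rule expectation_pmf_mono)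
      fix z :: "(nat \<Rightarrow> bool) \<times> (nat \<Rightarrow> bool) \<times> (nat \<Rightarrow> bool)"
      obtain x1 x2 y where z: "z = (x1, x2, y)" by (cases z)
      have "real T * \<mu> \<le> real T * ?D" using mean by (simp add: \<mu>_def mult_left_mono)
      then have "H T z \<subseteq> {s. real T * \<delta> \<le>
          \<bar>(\<Sum>t\<in>{1..T}. log_ratio p \<gamma> (x1 t, x2 t, y t, s t)) - real T * \<mu>\<bar>}"
        using False by (auto simp: H_def z threshold_def algebra_simps)
      then show "measure_pmf.prob (tilted_pmf T \<gamma> z) (H T z) \<le> (case z of (x1, x2, y) \<Rightarrow>
          measure_pmf.prob (tilted_pmf T \<gamma> (x1, x2, y))
        {s. real T * \<delta> \<le> \<bar>(\<Sum>t\<in>{1..T}. log_ratio p \<gamma> (x1 t, x2 t, y t, s t)) - real T * \<mu>\<bar>})"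
        by (auto simp: z intro!: measure_pmf.finite_measure_mono)
    qed simp
    also have "\<dots> \<le> real T * V / (real T * \<delta>)\<^sup>2"
      unfolding V_def \<mu>_def using that \<open>\<delta> > 0\<close> by (intro tilted_weak_law) simp
    also have "\<dots> = V / \<delta>\<^sup>2 / real T" using that by (simp add: power2_eq_square)
    finally show ?thesis .
  qed
  have "measure_pmf.expectation (context_pmf T p q10 q01)
      (\<lambda>z. measure_pmf.prob (tilted_pmf T \<gamma> z) (- cheap_confusable p q10 q01 \<epsilon> \<gamma> \<delta> T z))
      \<le> (128 / \<epsilon>\<^sup>2 + V / \<delta>\<^sup>2) / real T" if "T > 0" for T
  proof -
    have "measure_pmf.expectation (context_pmf T p q10 q01)
      (\<lambda>z. measure_pmf.prob (tilted_pmf T \<gamma> z) (- cheap_confusable p q10 q01 \<epsilon> \<gamma> \<delta> T z))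
      \<le> measure_pmf.expectation (context_pmf T p q10 q01)
      (\<lambda>z. measure_pmf.prob (tilted_pmf T \<gamma> z) (- confusable p q10 q01 \<epsilon> T z) +
         measure_pmf.prob (tilted_pmf T \<gamma> z) (H T z))"
    proof (rule expectation_pmf_mono)
      fix z
      have "- cheap_confusable p q10 q01 \<epsilon> \<gamma> \<delta> T z = - confusable p q10 q01 \<epsilon> T z \<union> H T z"
        by (auto simp: cheap_confusable_def H_def split: prod.splits)
      then show "measure_pmf.prob (tilted_pmf T \<gamma> z) (- cheap_confusable p q10 q01 \<epsilon> \<gamma> \<delta> T z) \<le>
        measure_pmf.prob (tilted_pmf T \<gamma> z) (- confusable p q10 q01 \<epsilon> T z) +
         measure_pmf.prob (tilted_pmf T \<gamma> z) (H T z)"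
        by (auto intro!: measure_Un_le)
    qed simp
    also have "\<dots> \<le> 128 / (real T * \<epsilon>\<^sup>2) + V / \<delta>\<^sup>2 / real T"
      using confusable_whp[OF par q m that \<open>\<epsilon> > 0\<close>] H[OF that]
      by (simp add: integrable_measure_pmf_finite)
    also have "\<dots> = (128 / \<epsilon>\<^sup>2 + V / \<delta>\<^sup>2) / real T" by (simp add: add_divide_distrib mult.commute)
    finally show ?thesis .
  qed
  with m show thesis by (rule that)
qed

text \<open>If the tilted codeword is cheap and confusable with probability at least 1/2, a fresh
  codeword is confusable with probability at least \<open>exp (- threshold) / 2\<close>. The other
  contexts are rare and cost \<open>C / T\<close>.\<close>

lemma one_minus_P3_le_large_T:
  assumes p: "0 < p" "p < 1" and q: "q10 \<in> {0..1}" "q01 \<in> {0..1}" and "\<epsilon> > 0" "\<delta> > 0"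
  obtains C where "\<And>N T. N \<ge> 2 \<Longrightarrow> T > 0 \<Longrightarrow> 1 - P3 p q10 q01 \<epsilon> N T \<le>
    exp (- (real (N - 2) * exp (- threshold (D_exp p q10 q01) \<delta> T) / 2)) + C / real T"
proof -
  obtain \<gamma> C where m: "matched p q10 q01 \<gamma>" and C:
    "\<And>T. T > 0 \<Longrightarrow> measure_pmf.expectation (context_pmf T p q10 q01)
      (\<lambda>z. measure_pmf.prob (tilted_pmf T \<gamma> z) (- cheap_confusable p q10 q01 \<epsilon> \<gamma> \<delta> T z)) \<le> C / real T"
    by (rule cheap_confusable_whp[OF assms]) blast
  have "1 - P3 p q10 q01 \<epsilon> N T \<le>
    exp (- (real (N - 2) * exp (- threshold (D_exp p q10 q01) \<delta> T) / 2)) + 2 * C / real T"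
    if "N \<ge> 2" "T > 0" for N T
  proof -
    let ?c = "exp (- threshold (D_exp p q10 q01) \<delta> T)"
    let ?e = "exp (- (real (N - 2) * ?c / 2))"
    let ?G = "cheap_confusable p q10 q01 \<epsilon> \<gamma> \<delta> T" and ?conf = "confusable p q10 q01 \<epsilon> T"
    have "1 - P3 p q10 q01 \<epsilon> N T \<le> measure_pmf.expectation (context_pmf T p q10 q01)
      (\<lambda>z. of_bool (true_edge p q10 q01 \<epsilon> T z) *
       (1 - measure_pmf.prob (row_pmf T p) (?conf z)) ^ (N - 2))"
      by (rule one_minus_P3_le[OF that(1)])
    also have "\<dots> \<le> measure_pmf.expectation (context_pmf T p q10 q01)
      (\<lambda>z. ?e + 2 * measure_pmf.prob (tilted_pmf T \<gamma> z) (- ?G z))"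
    proof (rule expectation_pmf_mono)
      fix z :: "(nat \<Rightarrow> bool) \<times> (nat \<Rightarrow> bool) \<times> (nat \<Rightarrow> bool)"
      let ?R = "measure_pmf.prob (row_pmf T p) (?conf z)" and ?f = "measure_pmf.prob (tilted_pmf T \<gamma> z) (?G z)"
      have compl: "measure_pmf.prob (tilted_pmf T \<gamma> z) (- ?G z) = 1 - ?f"
        using measure_pmf.prob_compl[of "?G z" "tilted_pmf T \<gamma> z"] by (simp add: Compl_eq_Diff_UNIV)
      have "?c * ?f \<le> measure_pmf.prob (row_pmf T p) (?G z)"
      proof (rule prob_change_of_measure)
        fix s assume s: "s \<in> ?G z"
        obtain x1 x2 y where z: "z = (x1, x2, y)" by (cases z)
        show "?c * pmf (tilted_pmf T \<gamma> z) s \<le> pmf (row_pmf T p) s"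
          using s m unfolding z
          by (intro tilted_likelihood_ratio p) (auto simp: cheap_confusable_def log_ratio_def matched_def)
      qed auto
      also have "\<dots> \<le> ?R"
        by (intro measure_pmf.finite_measure_mono) (auto simp: cheap_confusable_def)
      finally have R: "?c * ?f \<le> ?R" .
      \<comment> \<open>Markov's inequality in pointwise form: if \<open>?f < 1 / 2\<close>, the
        second summand alone exceeds 1.\<close>
      have pow: "(1 - ?R) ^ (N - 2) \<le> ?e + 2 * (1 - ?f)"
      proof (cases "?f \<ge> 1 / 2")
        case True
        have "?c * (1 / 2) \<le> ?c * ?f" using True by (intro mult_left_mono) auto
        with R have "?c / 2 \<le> ?R" by linarith
        moreover have "1 - ?R \<le> exp (- ?R)" using exp_ge_add_one_self[of "- ?R"] by linarith
        ultimately have "1 - ?R \<le> exp (- (?c / 2))" by (smt (verit) exp_le_cancel_iff)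
        then have "(1 - ?R) ^ (N - 2) \<le> exp (- (?c / 2)) ^ (N - 2)"
          by (intro power_mono) auto
        also have "\<dots> = ?e" unfolding exp_of_nat_mult[symmetric] by simp
        finally show ?thesis by (rule add_increasing2[rotated]) simp
      next
        case False
        have "(1 - ?R) ^ (N - 2) \<le> 1" by (intro power_le_one) auto
        also have "\<dots> \<le> 2 * (1 - ?f)" using False by simp
        also have "\<dots> \<le> ?e + 2 * (1 - ?f)" by simp
        finally show ?thesis .
      qed
      have "of_bool (true_edge p q10 q01 \<epsilon> T z) * (1 - ?R) ^ (N - 2) \<le> 1 * (1 - ?R) ^ (N - 2)"
        by (intro mult_right_mono zero_le_power) auto
      with pow show "of_bool (true_edge p q10 q01 \<epsilon> T z) * (1 - ?R) ^ (N - 2) \<le>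
          ?e + 2 * measure_pmf.prob (tilted_pmf T \<gamma> z) (- ?G z)"
        by (simp add: compl)
    qed simp
    also have "\<dots> \<le> ?e + 2 * (C / real T)"
      using C[OF that(2)] by (simp add: integrable_measure_pmf_finite)
    finally show ?thesis by simp
  qed
  then show thesis by (rule that)
qed

text \<open>The codeword \<open>x1 \<or> x2\<close> yields the same disjunction with either active
  user, hence it is confusable whenever {1, 2} is an edge. Each of its bits has mass at least
  \<open>c\<close>.\<close>

lemma one_minus_P3_le_small_T:
  assumes "p \<in> {0..1}"
  obtains c where "c > 0" "c \<le> 1" "p = 0 \<or> p = 1 \<Longrightarrow> c = 1"
    "\<And>N T. N \<ge> 2 \<Longrightarrow> 1 - P3 p q10 q01 \<epsilon> N T \<le> (1 - c ^ T) ^ (N - 2)"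
proof -
  \<comment> \<open>For \<open>p = 0\<close> or \<open>p = 1\<close> the minimum would be 0, but the
    only symbol in the support has mass 1.\<close>
  define c where "c = (if p = 0 \<or> p = 1 then 1 else min p (1 - p))"
  have c: "0 < c" "c \<le> 1" using assms by (auto simp: c_def)
  have bern: "c \<le> pmf (bernoulli_pmf p) (u \<or> v)"
    if "u \<in> set_pmf (bernoulli_pmf p)" "v \<in> set_pmf (bernoulli_pmf p)" for u v
    using that assms by (cases u; cases v) (auto simp: c_def set_pmf_iff)
  have "1 - P3 p q10 q01 \<epsilon> N T \<le> (1 - c ^ T) ^ (N - 2)" if "N \<ge> 2" for N T
  proof -
    have "1 - P3 p q10 q01 \<epsilon> N T \<le> measure_pmf.expectation (context_pmf T p q10 q01)
      (\<lambda>z. of_bool (true_edge p q10 q01 \<epsilon> T z) *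
       (1 - measure_pmf.prob (row_pmf T p) (confusable p q10 q01 \<epsilon> T z)) ^ (N - 2))"
      by (rule one_minus_P3_le[OF that])
    also have "\<dots> \<le> measure_pmf.expectation (context_pmf T p q10 q01) (\<lambda>z. (1 - c ^ T) ^ (N - 2))"
    proof (rule expectation_pmf_mono)
      fix z assume "z \<in> set_pmf (context_pmf T p q10 q01)"
      then obtain x1 x2 y where z: "z = (x1, x2, y)"
        and x: "x1 \<in> set_pmf (row_pmf T p)" "x2 \<in> set_pmf (row_pmf T p)"
        by (auto simp: context_pmf_def)
      let ?R = "measure_pmf.prob (row_pmf T p) (confusable p q10 q01 \<epsilon> T z)"
      have nonneg: "0 \<le> (1 - c ^ T) ^ (N - 2)" using c by (simp add: power_le_one)
      show "of_bool (true_edge p q10 q01 \<epsilon> T z) * (1 - ?R) ^ (N - 2) \<le> (1 - c ^ T) ^ (N - 2)"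
      proof (cases "true_edge p q10 q01 \<epsilon> T z")
        case True
        \<comment> \<open>Outside the rounds \<open>s\<close> takes the default value, without which
          its mass would be 0.\<close>
        define s where "s t \<longleftrightarrow> t \<in> {1..T} \<and> (x1 t \<or> x2 t)" for t
        have "(y, vec_or v s) \<in> typical_set p q10 q01 \<epsilon> T" if "v = x1 \<or> v = x2" for v
        proof (subst typical_set_cong[where v' = "vec_or x1 x2"])
          show "vec_or v s t = vec_or x1 x2 t" if "t \<in> {1..T}" for t
            using that \<open>v = x1 \<or> v = x2\<close> by (auto simp: s_def vec_or_def)
        qed (use True in \<open>simp add: true_edge_def z\<close>)
        then have "s \<in> confusable p q10 q01 \<epsilon> T z" by (simp add: confusable_def z)
        then have "pmf (row_pmf T p) s \<le> ?R"
          by (simp add: measure_pmf_single[symmetric] measure_pmf.finite_measure_mono)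
        moreover have "c ^ T \<le> pmf (row_pmf T p) s"
        proof -
          have "c ^ T = (\<Prod>t\<in>{1..T}. c)" by simp
          also have "\<dots> \<le> (\<Prod>t\<in>{1..T}. pmf (bernoulli_pmf p) (x1 t \<or> x2 t))"
            using x c by (intro prod_mono conjI bern)
              (auto simp: row_pmf_def set_Pi_pmf PiE_dflt_def)
          also have "\<dots> = (\<Prod>t\<in>{1..T}. pmf (bernoulli_pmf p) (s t))"
            by (intro prod.cong) (auto simp: s_def)
          also have "\<dots> = pmf (row_pmf T p) s"
            unfolding row_pmf_def by (subst pmf_Pi') (auto simp: s_def)
          finally show ?thesis .
        qed
        ultimately show ?thesis using True by (auto intro!: power_mono)
      qed (use nonneg in simp)
    qed simp
    finally show ?thesis by simp
  qed
  with c show thesis by (intro that[of c]) (auto simp: c_def)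
qed

section \<open>Asymptotics\<close>

lemma D_exp_nonneg:
  assumes p: "0 < p" "p < 1" and q: "q10 \<in> {0..1}" "q01 \<in> {0..1}"
  shows "D_exp p q10 q01 \<ge> 0"
  unfolding D_exp_eq[OF assms] using p q by (intro add_nonneg_nonneg Sup_objective_nonneg) auto

text \<open>The slack \<open>\<xi>\<close> is split: with
  \<open>\<delta> = \<xi> * D\<^sup>2 / 2\<close> the product
  \<open>(1 / D - \<xi>) * (D + \<delta>)\<close> stays below \<open>1 - \<xi> * D / 2\<close>. For
  \<open>D = 0\<close> both sides are 0 with \<open>\<kappa> = 1\<close>.\<close>

lemma threshold_le:
  assumes "D \<ge> 0" "\<xi> > 0"
  obtains \<delta> \<kappa> where "\<delta> > 0" "\<kappa> > 0"
    "\<And>T N. N \<ge> 2 \<Longrightarrow> ereal (real T / ln (real N)) \<le> 1 / ereal D - ereal \<xi> \<Longrightarrow>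
      threshold D \<delta> T \<le> (1 - \<kappa>) * ln (real N)"
proof (cases "D = 0")
  case True
  then show thesis by (intro that[of 1 1]) (auto simp: threshold_def)
next
  case False
  then have D: "D > 0" using assms by simp
  have "threshold D (\<xi> * D\<^sup>2 / 2) T \<le> (1 - \<xi> * D / 2) * ln (real N)"
    if N: "N \<ge> 2" and le: "ereal (real T / ln (real N)) \<le> 1 / ereal D - ereal \<xi>" for T N :: nat
  proof -
    have ln: "ln (real N) > 0" using N by simp
    have "1 / ereal D - ereal \<xi> = ereal (1 / D - \<xi>)" using D by (simp add: one_ereal_def)
    then have "real T / ln (real N) \<le> 1 / D - \<xi>" using le by simp
    then have T: "real T \<le> (1 / D - \<xi>) * ln (real N)" using ln by (simp add: pos_divide_le_eq)
    have "threshold D (\<xi> * D\<^sup>2 / 2) T = real T * (D + \<xi> * D\<^sup>2 / 2)"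
      using D by (simp add: threshold_def)
    also have "\<dots> \<le> (1 / D - \<xi>) * ln (real N) * (D + \<xi> * D\<^sup>2 / 2)"
      using T D assms by (intro mult_right_mono) auto
    also have "\<dots> = (1 - \<xi> * D / 2 - (\<xi> * D)\<^sup>2 / 2) * ln (real N)"
      using D by (simp add: field_simps power2_eq_square)
    also have "\<dots> \<le> (1 - \<xi> * D / 2) * ln (real N)"
      using ln by (intro mult_right_mono) auto
    finally show ?thesis .
  qed
  with D assms show thesis by (intro that[of "\<xi> * D\<^sup>2 / 2" "\<xi> * D / 2"]) auto
qed

text \<open>The expected number of confusable users, of order
  \<open>N * N powr (\<kappa> - 1) = N powr \<kappa>\<close>, tends to infinity.\<close>

lemma exp_neg_power_tendsto_0:
  assumes "\<kappa> > (0 :: real)"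
  shows "(\<lambda>N. exp (- (real (N - 2) * exp (- ((1 - \<kappa>) * ln (real N))) / 2))) \<longlonglongrightarrow> 0"
proof -
  have "((\<lambda>x. exp (- ((x - 2) / x * x powr \<kappa> / 2))) \<longlongrightarrow> 0) at_top"
    using assms by real_asymp
  then have "(\<lambda>N. exp (- ((real N - 2) / real N * real N powr \<kappa> / 2))) \<longlonglongrightarrow> 0"
    by (rule filterlim_compose[OF _ filterlim_real_sequentially])
  moreover have "\<forall>\<^sub>F N in sequentially. exp (- ((real N - 2) / real N * real N powr \<kappa> / 2)) =
      exp (- (real (N - 2) * exp (- ((1 - \<kappa>) * ln (real N))) / 2))"
    using eventually_ge_at_top[of 2]
  proof eventually_elim
    case (elim N)
    have "exp (- ((1 - \<kappa>) * ln (real N))) = exp (\<kappa> * ln (real N) - ln (real N))"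
      by (simp add: algebra_simps)
    also have "\<dots> = real N powr \<kappa> / real N" using elim by (simp add: exp_diff powr_def)
    finally show ?case using elim by (simp add: of_nat_diff)
  qed
  ultimately show ?thesis by (rule Lim_transform_eventually)
qed

lemma P3_le_1: "P3 p q10 q01 \<epsilon> N T \<le> 1"
  by (simp add: P3_def)

(* The rate condition is read in the extended reals, where 1 / 0 = \<infinity>: if the exponent is 0,
   it imposes no restriction on T. *)
theorem theorem2:
  fixes p q10 q01 \<xi> \<epsilon> :: real and T :: "nat \<Rightarrow> nat"
  assumes "p \<in> {0..1}" and "q10 \<in> {0..1}" and "q01 \<in> {0..1}"
    and "\<xi> > 0"
    and "\<forall>\<^sub>F N in sequentially.
           ereal (real (T N) / ln (real N)) \<le> 1 / ereal (D_exp p q10 q01) - ereal \<xi>"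
    and "\<epsilon> > 0"
  shows "(\<lambda>N. P3 p q10 q01 \<epsilon> N (T N)) \<longlonglongrightarrow> 1"
proof -
  obtain c where c: "c > 0" "c \<le> 1" "p = 0 \<or> p = 1 \<Longrightarrow> c = 1"
    and small: "\<And>N T. N \<ge> 2 \<Longrightarrow> 1 - P3 p q10 q01 \<epsilon> N T \<le> (1 - c ^ T) ^ (N - 2)"
    using one_minus_P3_le_small_T[OF assms(1), of q10 q01 \<epsilon>] by blast
  show ?thesis
  proof (cases "p = 0 \<or> p = 1")
    case True
    \<comment> \<open>With \<open>c = 1\<close> the bound is \<open>0 ^ (N - 2)\<close>, which is 0
      only from \<open>N = 3\<close> on.\<close>
    have "P3 p q10 q01 \<epsilon> N (T N) = 1" if "N \<ge> 3" for N
      using small[of N "T N"] c(3)[OF True] that P3_le_1[of p q10 q01 \<epsilon> N "T N"] by (simp add: power_0_left)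
    then have "\<forall>\<^sub>F N in sequentially. P3 p q10 q01 \<epsilon> N (T N) = 1"
      by (auto simp: eventually_at_top_linorder)
    then show ?thesis by (rule tendsto_eventually)
  next
    case False
    then have p: "0 < p" "p < 1" using assms(1) by auto
    note q = assms(2,3)
    obtain \<delta> \<kappa> where "\<delta> > 0" "\<kappa> > 0" and thr:
      "\<And>T N. N \<ge> 2 \<Longrightarrow> ereal (real T / ln (real N)) \<le> 1 / ereal (D_exp p q10 q01) - ereal \<xi> \<Longrightarrow>
        threshold (D_exp p q10 q01) \<delta> T \<le> (1 - \<kappa>) * ln (real N)"
      by (rule threshold_le[OF D_exp_nonneg[OF p q] \<open>\<xi> > 0\<close>]) blast
    obtain C where large: "\<And>N T. N \<ge> 2 \<Longrightarrow> T > 0 \<Longrightarrow> 1 - P3 p q10 q01 \<epsilon> N T \<le>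
        exp (- (real (N - 2) * exp (- threshold (D_exp p q10 q01) \<delta> T) / 2)) + C / real T"
      by (rule one_minus_P3_le_large_T[OF p q \<open>\<epsilon> > 0\<close> \<open>\<delta> > 0\<close>]) blast
    show ?thesis
    proof (rule tendstoI)
      fix \<eta> :: real assume "\<eta> > 0"
      \<comment> \<open>The sequence \<open>T\<close> may oscillate, so the cases are split for each
        \<open>N\<close>: from \<open>T0\<close> on the error \<open>C / T\<close> is below
        \<open>\<eta> / 2\<close>, and below \<open>T0\<close> the bound for small \<open>T\<close>
        is uniform, since \<open>c ^ T \<ge> c ^ T0\<close>.\<close>
      obtain T0 :: nat where T0: "T0 > 0" "\<bar>C\<bar> / (\<eta> / 2) < real T0"
        using reals_Archimedean2[of "max 0 (\<bar>C\<bar> / (\<eta> / 2))"] by auto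
      have "(\<lambda>n. (1 - c ^ T0) ^ n) \<longlonglongrightarrow> 0"
        using c(1) power_le_one[of c T0] c(2) by (intro LIMSEQ_power_zero) (auto simp: abs_if)
      then have "(\<lambda>N. (1 - c ^ T0) ^ (N - 2)) \<longlonglongrightarrow> 0"
        by (rule filterlim_compose) (rule filterlim_minus_const_nat_at_top)
      then have "\<forall>\<^sub>F N in sequentially. (1 - c ^ T0) ^ (N - 2) < \<eta>"
        using \<open>\<eta> > 0\<close> by (rule order_tendstoD)
      moreover have "\<forall>\<^sub>F N in sequentially.
          exp (- (real (N - 2) * exp (- ((1 - \<kappa>) * ln (real N))) / 2)) < \<eta> / 2"
        using exp_neg_power_tendsto_0[OF \<open>\<kappa> > 0\<close>] \<open>\<eta> > 0\<close> by (intro order_tendstoD) auto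
      ultimately show "\<forall>\<^sub>F N in sequentially. dist (P3 p q10 q01 \<epsilon> N (T N)) 1 < \<eta>"
        using assms(5) eventually_ge_at_top[of 2]
      proof eventually_elim
        case (elim N)
        have "1 - P3 p q10 q01 \<epsilon> N (T N) < \<eta>"
        proof (cases "T N < T0")
          case True
          have "c ^ T0 \<le> c ^ T N" using c True by (intro power_decreasing) auto
          then have "(1 - c ^ T N) ^ (N - 2) \<le> (1 - c ^ T0) ^ (N - 2)"
            using c by (intro power_mono) (auto simp: power_le_one)
          then show ?thesis using small[OF elim(4), of "T N"] elim(1) by linarith
        next
          case False
          have "C / real (T N) \<le> \<bar>C\<bar> / real T0"
            using False T0 by (intro frac_le) auto
          also have "\<dots> < \<eta> / 2" using T0 \<open>\<eta> > 0\<close> by (simp add: field_simps)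
          finally have 1: "C / real (T N) < \<eta> / 2" .
          have "exp (- ((1 - \<kappa>) * ln (real N))) \<le> exp (- threshold (D_exp p q10 q01) \<delta> (T N))"
            using thr[OF elim(4,3)] by simp
          then have "real (N - 2) * exp (- ((1 - \<kappa>) * ln (real N))) / 2 \<le>
              real (N - 2) * exp (- threshold (D_exp p q10 q01) \<delta> (T N)) / 2"
            by (intro divide_right_mono mult_left_mono) auto
          then have "exp (- (real (N - 2) * exp (- threshold (D_exp p q10 q01) \<delta> (T N)) / 2)) \<le>
              exp (- (real (N - 2) * exp (- ((1 - \<kappa>) * ln (real N))) / 2))"
            by simp
          also note elim(2)
          finally show ?thesis using 1 large[OF elim(4), of "T N"] False T0 by linarith
        qed
        then show ?case using P3_le_1[of p q10 q01 \<epsilon> N "T N"] by (simp add: dist_real_def)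
      qed
    qed
  qed
qed

end
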